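(* Let $m,p,n\geq1$, let $X_1,\dots,X_n$ be independent random variables with $X_i$ taking values in a set $S_i$, and let $F:S_1\times\cdots\times S_n\to\mathbb{C}^{m\times m\times p}$ be a function whose values are Hermitian T-product tensors. Let $\mathcal{A}_1,\dots,\mathcal{A}_n\in\mathbb{C}^{m\times m\times p}$ be Hermitian T-product tensors such that for every $1\leq i\leq n$, all $(x_1,\dots,x_n)\in S_1\times\cdots\times S_n$ and all $x_i'\in S_i$, $$\left(F(x_1,\dots,x_i,\dots,x_n)-F(x_1,\dots,x_i',\dots,x_n)\right)^2\preceq\mathcal{A}_i^2.$$ Let $\sigma^2=\left\Vert\sum_{i=1}^n\mathcal{A}_i^2\right\Vert$. Then for all $\theta\geq0$, $$\Pr\left(\lambda_{\max}\left(F(X_1,\dots,X_n)-\mathbb{E}F(X_1,\dots,X_n)\right)\geq\theta\right)\leq mp\,e^{-\theta^2/(8\sigma^2)}.$$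
   Context: For $\mathcal{A}\in\mathbb{C}^{m\times n\times p}$ with frontal slices $A^{(1)},\dots,A^{(p)}$, $\mathrm{bcirc}(\mathcal{A})\in\mathbb{C}^{mp\times np}$ is the block circulant matrix whose $(r,s)$ block is $A^{(((r-s)\bmod p)+1)}$. The T-product $\mathcal{A}\star\mathcal{B}$ is the tensor with $\mathrm{bcirc}(\mathcal{A}\star\mathcal{B})=\mathrm{bcirc}(\mathcal{A})\mathrm{bcirc}(\mathcal{B})$, and $\mathcal{A}^2=\mathcal{A}\star\mathcal{A}$. The conjugate transpose $\mathcal{A}^{\mathrm H}$ is obtained by conjugate-transposing every frontal slice and reversing the order of slices $2,\dots,p$. $\mathcal{A}\in\mathbb{C}^{m\times m\times p}$ is Hermitian if $\mathcal{A}^{\mathrm H}=\mathcal{A}$; its eigenvalues are the $mp$ eigenvalues of $\mathrm{bcirc}(\mathcal{A})$, with largest $\lambda_{\max}$. For Hermitian $\mathcal{A},\mathcal{B}$, $\mathcal{A}\preceq\mathcal{B}$ means $\mathrm{bcirc}(\mathcal{B}-\mathcal{A})$ is positive semidefinite. $\Vert\mathcal{A}\Vert$ is the largest singular value of $\mathrm{bcirc}(\mathcal{A})$. Expectation is entrywise. *)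

theory Defs
  imports "HOL-Probability.Probability" "Jordan_Normal_Form.Matrix" "Jordan_Normal_Form.Char_Poly"
    "Jordan_Normal_Form.Schur_Decomposition"
begin

text \<open>Third-order tensors in C^(m x n x p) are represented by their frontal slices:
  a function from the (0-based) slice index k < p to complex matrices.
  Slices with index >= p are irrelevant.\<close>

type_synonym tensor = "nat \<Rightarrow> complex mat"

definition is_tensor :: "nat \<Rightarrow> nat \<Rightarrow> nat \<Rightarrow> tensor \<Rightarrow> bool" where
  "is_tensor m n p A \<longleftrightarrow> (\<forall>k<p. A k \<in> carrier_mat m n)"

text \<open>Block circulant matrix: the (r,s) block (0-based) is slice ((r - s) mod p).\<close>
definition bcirc :: "nat \<Rightarrow> nat \<Rightarrow> nat \<Rightarrow> tensor \<Rightarrow> complex mat" where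
  "bcirc m n p A = mat (m * p) (n * p)
     (\<lambda>(i, j). A ((i div m + p - j div n) mod p) $$ (i mod m, j mod n))"

text \<open>T-product of A (m x l x p) and B (l x n x p): slice k is
  sum over r of A^((k - r) mod p) * B^(r); so bcirc (A*B) = bcirc A * bcirc B.\<close>
definition tprod :: "nat \<Rightarrow> nat \<Rightarrow> nat \<Rightarrow> nat \<Rightarrow> tensor \<Rightarrow> tensor \<Rightarrow> tensor" where
  "tprod m l n p A B = (\<lambda>k. mat m n (\<lambda>(i, j).
      \<Sum>r<p. \<Sum>q<l. A ((k + p - r) mod p) $$ (i, q) * B r $$ (q, j)))"

definition tsq :: "nat \<Rightarrow> nat \<Rightarrow> tensor \<Rightarrow> tensor" where
  "tsq m p A = tprod m m m p A A"

definition tadd :: "tensor \<Rightarrow> tensor \<Rightarrow> tensor" where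
  "tadd A B = (\<lambda>k. A k + B k)"

definition tminus :: "tensor \<Rightarrow> tensor \<Rightarrow> tensor" where
  "tminus A B = (\<lambda>k. A k - B k)"

definition tsum :: "nat \<Rightarrow> nat \<Rightarrow> (nat \<Rightarrow> tensor) \<Rightarrow> nat set \<Rightarrow> tensor" where
  "tsum m n A I = (\<lambda>k. mat m n (\<lambda>(i, j). \<Sum>t\<in>I. A t k $$ (i, j)))"

text \<open>Conjugate transpose: conjugate-transpose each slice and reverse slices 2..p
  (0-based: slice k of the result is the adjoint of slice (p - k) mod p).\<close>
definition tconj :: "nat \<Rightarrow> tensor \<Rightarrow> tensor" where
  "tconj p A = (\<lambda>k. mat_adjoint (A ((p - k) mod p)))"

definition hermitian_tensor :: "nat \<Rightarrow> nat \<Rightarrow> tensor \<Rightarrow> bool" where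
  "hermitian_tensor m p A \<longleftrightarrow> is_tensor m m p A \<and> (\<forall>k<p. tconj p A k = A k)"

definition psd_mat :: "nat \<Rightarrow> complex mat \<Rightarrow> bool" where
  "psd_mat N M \<longleftrightarrow> M \<in> carrier_mat N N \<and>
     (\<forall>v \<in> carrier_vec N. (M *\<^sub>v v) \<bullet>c v \<in> \<real> \<and> 0 \<le> Re ((M *\<^sub>v v) \<bullet>c v))"

definition tle :: "nat \<Rightarrow> nat \<Rightarrow> tensor \<Rightarrow> tensor \<Rightarrow> bool" where
  "tle m p A B \<longleftrightarrow> psd_mat (m * p) (bcirc m m p (tminus B A))"

text \<open>Largest eigenvalue of a Hermitian tensor (eigenvalues of bcirc are real).\<close>
definition lambda_max :: "nat \<Rightarrow> nat \<Rightarrow> tensor \<Rightarrow> real" where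
  "lambda_max m p A = Max {Re c | c. eigenvalue (bcirc m m p A) c}"

definition tnorm :: "nat \<Rightarrow> nat \<Rightarrow> nat \<Rightarrow> tensor \<Rightarrow> real" where
  "tnorm m n p A = sqrt (Max {Re c | c. eigenvalue (mat_adjoint (bcirc m n p A) * bcirc m n p A) c})"

end

theory Submission
  imports Defs "Jordan_Normal_Form.Spectral_Radius"
begin

text \<open>
  With \<open>Y = F(X) - E F(X)\<close> (block circulant form) and \<open>m(t) = E tr exp (t Y)\<close>, write \<open>Y\<close> as a sum of
  martingale differences \<open>D\<^sub>k\<close>. Since \<open>D\<^sub>k\<close> averages to zero over the \<open>k\<close>-th coordinate,
  \<open>E tr (D\<^sub>k exp (t Y)) = E tr (D\<^sub>k (exp (t Y) - exp (t Y')))\<close>, where \<open>Y'\<close> has the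
  \<open>k\<close>-th coordinate resampled inside the exponential only. A mean value inequality for the trace
  exponential, proved by expanding in the eigenbases of \<open>Y\<close> and \<open>Y'\<close>, bounds this by
  \<open>2 t E tr (A\<^sub>k\<^sup>2 exp (t Y))\<close>, because \<open>D\<^sub>k\<^sup>2\<close> and \<open>(Y - Y')\<^sup>2\<close> are both dominated by
  \<open>A\<^sub>k\<^sup>2\<close>. Summing over \<open>k\<close> gives \<open>m'(t) \<le> 2 t \<sigma>\<^sup>2 m(t)\<close>, hence (crudely)
  \<open>m(t) \<le> m p exp (2 \<sigma>\<^sup>2 t\<^sup>2)\<close>, and Markov's inequality with \<open>t = \<theta> / (4 \<sigma>\<^sup>2)\<close> concludes.
  Neither Lieb's concavity theorem nor the Golden-Thompson inequality is needed.
\<close>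

section \<open>Spectral theorem for Hermitian matrices\<close>

text \<open>What survives is the derivative of \<open>E tr exp (t Y)\<close>: in
  \<open>E tr (Y exp (t Y))\<close> a single exponential stands under the trace. The mean value
  inequality yields \<open>t * E tr (A_k^2 exp (t Y))\<close> plus the same term with
  \<open>Y'\<close>; as \<open>Y\<close> and \<open>Y'\<close> have the same law, both expectations
  agree, whence the factor \<open>2 t\<close>. The dimension \<open>m p\<close> is the value of the
  moment generating function at 0, the trace of the identity. Integrating the differential
  inequality exactly would give the exponent \<open>\<sigma>^2 t^2\<close>; the weaker
  \<open>2 \<sigma>^2 t^2\<close> already produces the 8 of the statement, since
  \<open>2 \<sigma>^2 t^2 - t \<theta>\<close> has minimum
  \<open>- \<theta>^2 / (8 \<sigma>^2)\<close>. This slack allows finite steps in place of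
  differentiation under the integral.\<close>

definition cinner :: "nat \<Rightarrow> (nat \<Rightarrow> complex) \<Rightarrow> (nat \<Rightarrow> complex) \<Rightarrow> complex" where
  "cinner d u v = (\<Sum>i<d. cnj (u i) * v i)"

text \<open>Vectors and matrices are plain functions of which only the indices below
  \<open>d\<close> count, so entries can be integrated and tested for measurability without carrier
  conditions.\<close>

definition mapply :: "nat \<Rightarrow> (nat \<Rightarrow> nat \<Rightarrow> complex) \<Rightarrow> (nat \<Rightarrow> complex) \<Rightarrow> nat \<Rightarrow> complex" where
  "mapply d H v = (\<lambda>i. \<Sum>j<d. H i j * v j)"

definition sqnorm :: "nat \<Rightarrow> (nat \<Rightarrow> complex) \<Rightarrow> real" where
  "sqnorm d v = (\<Sum>i<d. (cmod (v i))\<^sup>2)"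

definition hermitian_fun :: "nat \<Rightarrow> (nat \<Rightarrow> nat \<Rightarrow> complex) \<Rightarrow> bool" where
  "hermitian_fun d H \<longleftrightarrow> (\<forall>i<d. \<forall>j<d. H i j = cnj (H j i))"

text \<open>The last clause is the resolution of the identity, the form in which the basis is used
  in every expansion below.\<close>

definition eigenbasis ::
    "nat \<Rightarrow> (nat \<Rightarrow> nat \<Rightarrow> complex) \<Rightarrow> (nat \<Rightarrow> real) \<Rightarrow> (nat \<Rightarrow> nat \<Rightarrow> complex) \<Rightarrow> bool" where
  "eigenbasis d H lam u \<longleftrightarrow>
     (\<forall>k<d. \<forall>i<d. mapply d H (u k) i = of_real (lam k) * u k i) \<and>
     (\<forall>k<d. \<forall>l<d. cinner d (u k) (u l) = (if k = l then 1 else 0)) \<and>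
     (\<forall>i<d. \<forall>j<d. (\<Sum>k<d. u k i * cnj (u k j)) = (if i = j then 1 else 0))"

lemma cinner_self: "cinner d v v = of_real (sqnorm d v)"
  unfolding cinner_def sqnorm_def of_real_sum
  by (intro sum.cong refl) (simp add: complex_norm_square mult.commute flip: of_real_power)

lemma sqnorm_nonneg [simp]: "sqnorm d v \<ge> 0"
  unfolding sqnorm_def by (intro sum_nonneg) simp

lemma sqnorm_eq_0_iff: "sqnorm d v = 0 \<longleftrightarrow> (\<forall>i<d. v i = 0)"
  unfolding sqnorm_def by (subst sum_nonneg_eq_0_iff) auto

lemma cinner_cong:
  "(\<And>i. i < d \<Longrightarrow> u i = u' i) \<Longrightarrow> (\<And>i. i < d \<Longrightarrow> v i = v' i) \<Longrightarrow> cinner d u v = cinner d u' v'"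
  unfolding cinner_def by (intro sum.cong refl) auto

lemma cinner_commute: "cinner d u v = cnj (cinner d v u)"
  unfolding cinner_def by (simp add: mult.commute)

lemma cinner_smult_right: "cinner d u (\<lambda>i. c * v i) = c * cinner d u v"
  unfolding cinner_def sum_distrib_left by (intro sum.cong refl) (simp add: algebra_simps)

lemma cinner_smult_left: "cinner d (\<lambda>i. c * u i) v = cnj c * cinner d u v"
  unfolding cinner_def sum_distrib_left by (intro sum.cong refl) (simp add: algebra_simps)

lemma cinner_sum_right: "cinner d u (\<lambda>i. \<Sum>k\<in>K. v k i) = (\<Sum>k\<in>K. cinner d u (v k))"
  unfolding cinner_def sum_distrib_left by (rule sum.swap)

lemma cinner_mapply_hermitian:
  assumes "hermitian_fun d H"
  shows "cinner d u (mapply d H v) = cinner d (mapply d H u) v"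
proof -
  have "cinner d u (mapply d H v) = (\<Sum>i<d. \<Sum>j<d. cnj (u i) * H i j * v j)"
    unfolding cinner_def mapply_def sum_distrib_left by (simp add: mult.assoc)
  also have "\<dots> = (\<Sum>j<d. \<Sum>i<d. cnj (u i) * H i j * v j)"
    by (rule sum.swap)
  also have "\<dots> = (\<Sum>j<d. \<Sum>i<d. cnj (H j i * u i) * v j)"
    using assms unfolding hermitian_fun_def
    by (intro sum.cong refl) (metis complex_cnj_cnj complex_cnj_mult lessThan_iff mult.commute)
  also have "\<dots> = cinner d (mapply d H u) v"
    unfolding cinner_def mapply_def cnj_sum sum_distrib_right ..
  finally show ?thesis .
qed

section \<open>Trace of a matrix with a single eigenvalue\<close>

lemma index_mat_mult_sum:
  assumes "A \<in> carrier_mat n l" "B \<in> carrier_mat l m" "i < n" "j < m"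
  shows "(A * B) $$ (i, j) = (\<Sum>k<l. A $$ (i, k) * B $$ (k, j))"
  using assms by (auto simp: scalar_prod_def atLeast0LessThan intro!: sum.cong)

lemma sum_diag_similar_mat:
  fixes A :: "complex mat"
  assumes A: "A \<in> carrier_mat d d" and sim: "similar_mat A B"
  shows "(\<Sum>i<d. A $$ (i, i)) = (\<Sum>i<d. B $$ (i, i))"
proof -
  obtain P Q where wit: "similar_mat_wit A B P Q"
    using sim unfolding similar_mat_def by blast
  note w = similar_mat_witD2[OF A wit]
  have C: "B * Q \<in> carrier_mat d d" using w by simp
  have "A = P * (B * Q)" using w by simp
  then have "(\<Sum>i<d. A $$ (i, i)) = (\<Sum>i<d. \<Sum>j<d. P $$ (i, j) * (B * Q) $$ (j, i))"
    using index_mat_mult_sum[OF w(6) C] by simp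
  also have "\<dots> = (\<Sum>j<d. \<Sum>i<d. (B * Q) $$ (j, i) * P $$ (i, j))"
    by (subst sum.swap) (simp add: mult.commute)
  also have "\<dots> = (\<Sum>j<d. (B * Q * P) $$ (j, j))"
    using index_mat_mult_sum[OF C w(6)] by simp
  also have "B * Q * P = B"
    using w by (metis assoc_mult_mat right_mult_one_mat)
  finally show ?thesis .
qed

text \<open>A Schur form of \<open>A\<close> carries the roots of the characteristic polynomial on
  its diagonal. They all equal \<open>a\<close>, and the trace is invariant under
  similarity.\<close>

lemma sum_diag_unique_eigenvalue:
  fixes A :: "complex mat"
  assumes A: "A \<in> carrier_mat d d" and uniq: "\<And>c. eigenvalue A c \<Longrightarrow> c = a"
  shows "(\<Sum>i<d. A $$ (i, i)) = of_nat d * a"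
proof -
  obtain as where cp: "char_poly A = (\<Prod>a\<leftarrow>as. [:- a, 1:])" and len: "length as = d"
    using char_poly_factorized[OF A] by blast
  obtain B P Q where S: "schur_decomposition A as = (B, P, Q)"
    by (cases "schur_decomposition A as") auto
  have wit: "similar_mat_wit A B P Q" and diag: "diag_mat B = as"
    using schur_decomposition[OF A cp S] by auto
  have "poly (char_poly A) b = 0" if "b \<in> set as" for b
    unfolding cp poly_prod_list using that by (auto simp: prod_list_zero_iff image_iff)
  then have all: "b = a" if "b \<in> set as" for b
    using uniq eigenvalue_root_char_poly[OF A] that by blast
  have B: "B \<in> carrier_mat d d" using similar_mat_witD2[OF A wit] by blast
  have "B $$ (i, i) = a" if "i < d" for i
  proof -
    have "B $$ (i, i) = as ! i" using B that unfolding diag[symmetric] diag_mat_def by simp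
    then show ?thesis using all that len by auto
  qed
  then show ?thesis
    using sum_diag_similar_mat[OF A, of B] wit unfolding similar_mat_def by auto
qed

section \<open>Inductive construction of an orthonormal eigenbasis\<close>

definition eigensystem ::
    "nat \<Rightarrow> nat \<Rightarrow> (nat \<Rightarrow> nat \<Rightarrow> complex) \<Rightarrow> (nat \<Rightarrow> real) \<Rightarrow> (nat \<Rightarrow> nat \<Rightarrow> complex) \<Rightarrow> bool" where
  "eigensystem d k H lam u \<longleftrightarrow>
     (\<forall>j<k. \<forall>i<d. mapply d H (u j) i = of_real (lam j) * u j i) \<and>
     (\<forall>j<k. \<forall>l<k. cinner d (u j) (u l) = (if j = l then 1 else 0))"

lemma hermitian_fun_diag_real: "hermitian_fun d H \<Longrightarrow> i < d \<Longrightarrow> Im (H i i) = 0"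
  unfolding hermitian_fun_def by (metis Reals_cnj_iff complex_is_Real_iff)

text \<open>Moving the known eigenvalues to the non-real number \<open>\<i>\<close> makes the trace of the
  perturbed matrix differ from \<open>d * \<i>\<close>, so that a further eigenvalue must exist.\<close>

lemma new_eigenvector:
  assumes herm: "hermitian_fun d H" and sys: "eigensystem d k H lam u" and kd: "k < d"
  shows "\<exists>x c. (\<exists>i<d. x i \<noteq> 0) \<and> (\<forall>i<d. mapply d H x i = c * x i) \<and> (\<forall>j<k. cinner d (u j) x = 0)"
proof -
  \<comment> \<open>\<open>K\<close> gives every known eigenvector \<open>u j\<close> the eigenvalue
    \<open>\<i>\<close> and agrees with \<open>H\<close> on their orthogonal complement.\<close>
  define K where "K = (\<lambda>a b. H a b + (\<Sum>j<k. (\<i> - of_real (lam j)) * u j a * cnj (u j b)))"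
  define KM where "KM = mat d d (\<lambda>(a, b). K a b)"
  have KM: "KM \<in> carrier_mat d d" unfolding KM_def by simp
  have unit: "(\<Sum>a<d. u j a * cnj (u j a)) = 1" if "j < k" for j
    using sys that unfolding eigensystem_def cinner_def by (simp add: mult.commute)
  have "(\<Sum>a<d. KM $$ (a, a)) = (\<Sum>a<d. H a a) + (\<Sum>a<d. \<Sum>j<k. (\<i> - of_real (lam j)) * u j a * cnj (u j a))"
    unfolding KM_def K_def by (simp add: sum.distrib)
  also have "(\<Sum>a<d. \<Sum>j<k. (\<i> - of_real (lam j)) * u j a * cnj (u j a))
      = (\<Sum>j<k. (\<i> - of_real (lam j)) * (\<Sum>a<d. u j a * cnj (u j a)))"
    by (subst sum.swap) (simp add: sum_distrib_left mult.assoc)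
  also have "\<dots> = (\<Sum>j<k. \<i> - of_real (lam j))"
    by (intro sum.cong refl) (simp add: unit)
  finally have tr: "(\<Sum>a<d. KM $$ (a, a)) = (\<Sum>a<d. H a a) + (\<Sum>j<k. \<i> - of_real (lam j))" .
  have "Im (\<Sum>a<d. KM $$ (a, a)) = of_nat k"
    unfolding tr by (simp add: hermitian_fun_diag_real[OF herm])
  moreover have "Im (of_nat d * \<i>) = of_nat d"
    by simp
  ultimately have "(\<Sum>a<d. KM $$ (a, a)) \<noteq> of_nat d * \<i>"
    using kd by (metis less_irrefl of_nat_eq_iff)
  then obtain c where "eigenvalue KM c" and c: "c \<noteq> \<i>"
    using sum_diag_unique_eigenvalue[OF KM, of \<i>] by blast
  then obtain w where w: "w \<in> carrier_vec d" "w \<noteq> 0\<^sub>v d" "KM *\<^sub>v w = c \<cdot>\<^sub>v w"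
    using KM unfolding eigenvalue_def eigenvector_def by auto
  define x where "x = (\<lambda>i. w $ i)"
  have nz: "\<exists>i<d. x i \<noteq> 0"
    using w unfolding x_def by (metis carrier_vecD eq_vecI index_zero_vec)
  have Kx: "mapply d K x a = c * x a" if a: "a < d" for a
  proof -
    have "mapply d K x a = (KM *\<^sub>v w) $ a"
      unfolding mapply_def x_def KM_def using a w(1)
      by (simp add: scalar_prod_def atLeast0LessThan)
    then show ?thesis using w a by (simp add: x_def)
  qed
  have Kx': "mapply d K y a = mapply d H y a + (\<Sum>j<k. (\<i> - of_real (lam j)) * cinner d (u j) y * u j a)"
    for y a
  proof -
    have "(\<Sum>b<d. (\<Sum>j<k. (\<i> - of_real (lam j)) * u j a * cnj (u j b)) * y b)
      = (\<Sum>j<k. (\<i> - of_real (lam j)) * cinner d (u j) y * u j a)"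
      unfolding cinner_def sum_distrib_left sum_distrib_right
      by (subst sum.swap) (simp add: algebra_simps)
    then show ?thesis
      unfolding mapply_def K_def by (simp add: algebra_simps sum.distrib)
  qed
  have orth: "cinner d (u l) x = 0" if l: "l < k" for l
  proof -
    \<comment> \<open>In the pairing of \<open>K x = c x\<close> with \<open>u l\<close> the value
      \<open>lam l\<close> coming from \<open>H\<close> cancels against the perturbation and leaves
      \<open>\<i>\<close>, so \<open>c \<noteq> \<i>\<close> forces orthogonality. On such an
      \<open>x\<close> the perturbation vanishes, so \<open>x\<close> is an eigenvector of
      \<open>H\<close> itself.\<close>
    have "c * cinner d (u l) x = cinner d (u l) (mapply d K x)"
      using Kx by (subst cinner_smult_right[symmetric]) (intro cinner_cong, auto)
    also have "\<dots> = cinner d (u l) (mapply d H x)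
        + (\<Sum>j<k. cinner d (u l) (\<lambda>a. (\<i> - of_real (lam j)) * cinner d (u j) x * u j a))"
      unfolding Kx' cinner_sum_right[symmetric]
      by (simp add: cinner_def algebra_simps sum.distrib)
    also have "cinner d (u l) (mapply d H x) = cinner d (\<lambda>i. of_real (lam l) * u l i) x"
      unfolding cinner_mapply_hermitian[OF herm]
      using sys l unfolding eigensystem_def by (intro cinner_cong) auto
    also have "(\<Sum>j<k. cinner d (u l) (\<lambda>a. (\<i> - of_real (lam j)) * cinner d (u j) x * u j a))
       = (\<Sum>j<k. if j = l then (\<i> - of_real (lam j)) * cinner d (u j) x else 0)"
      unfolding cinner_smult_right
      using sys l unfolding eigensystem_def by (intro sum.cong refl) auto
    finally have "c * cinner d (u l) x = \<i> * cinner d (u l) x"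
      using l by (simp add: cinner_smult_left algebra_simps)
    then show ?thesis using c by simp
  qed
  have "mapply d H x a = c * x a" if "a < d" for a
    using Kx[OF that] Kx'[of x a] orth by simp
  then show ?thesis using nz orth by blast
qed

lemma extend_eigensystem:
  assumes herm: "hermitian_fun d H" and sys: "eigensystem d k H lam u" and kd: "k < d"
  shows "\<exists>lam' u'. eigensystem d (Suc k) H lam' u'"
proof -
  obtain x c where nz: "\<exists>i<d. x i \<noteq> 0" and ev: "\<And>i. i < d \<Longrightarrow> mapply d H x i = c * x i"
    and orth: "\<And>j. j < k \<Longrightarrow> cinner d (u j) x = 0"
    using new_eigenvector[OF assms] by blast
  have pos: "sqnorm d x > 0"
    using nz sqnorm_eq_0_iff[of d x] sqnorm_nonneg[of d x] by (metis less_eq_real_def)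
  \<comment> \<open>Symmetry of \<open>H\<close> gives \<open>c = cnj c\<close>, so the eigenvalue
    can be stored as a real number.\<close>
  have "c * cinner d x x = cinner d x (mapply d H x)"
    using ev by (subst cinner_smult_right[symmetric]) (intro cinner_cong, auto)
  also have "\<dots> = cinner d (\<lambda>i. c * x i) x"
    unfolding cinner_mapply_hermitian[OF herm] using ev by (intro cinner_cong) auto
  finally have "c = cnj c" using pos by (simp add: cinner_smult_left cinner_self)
  then have c: "c = of_real (Re c)" by (metis Reals_cnj_iff of_real_Re)
  define y where "y = (\<lambda>i. of_real (1 / sqrt (sqnorm d x)) * x i)"
  have "cinner d y y = 1"
    unfolding y_def cinner_smult_left cinner_smult_right cinner_self using pos
    by (simp flip: of_real_mult of_real_divide)
  moreover have y: "cinner d (u j) y = 0" if "j < k" for j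
    unfolding y_def cinner_smult_right using orth that by simp
  moreover have "cinner d y (u j) = 0" if "j < k" for j
    using y[OF that] by (subst cinner_commute) simp
  moreover have "mapply d H y i = of_real (Re c) * y i" if "i < d" for i
  proof -
    have "mapply d H y i = of_real (1 / sqrt (sqnorm d x)) * mapply d H x i"
      unfolding y_def mapply_def sum_distrib_left by (simp add: algebra_simps)
    then show ?thesis using ev[OF that] c by (simp add: y_def)
  qed
  ultimately have "eigensystem d (Suc k) H (lam(k := Re c)) (u(k := y))"
    using sys unfolding eigensystem_def by (auto simp: less_Suc_eq)
  then show ?thesis by blast
qed

theorem hermitian_eigenbasis_exists:
  assumes herm: "hermitian_fun d H"
  shows "\<exists>lam u. eigenbasis d H lam u"
proof -
  have "\<exists>lam u. eigensystem d k H lam u" if "k \<le> d" for k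
    using that
  proof (induction k)
    case 0
    show ?case by (simp add: eigensystem_def)
  next
    case (Suc k)
    then show ?case using extend_eigensystem[OF herm] by (meson Suc_le_eq less_imp_le)
  qed
  then obtain lam u where sys: "eigensystem d d H lam u" by blast
  define U where "U = mat d d (\<lambda>(k, i). cnj (u k i))"
  define V where "V = mat d d (\<lambda>(i, k). u k i)"
  \<comment> \<open>Orthonormality says that \<open>U\<close> is a left inverse of \<open>V\<close>;
    for square matrices it is then a right inverse, which is completeness.\<close>
  have "U * V = 1\<^sub>m d"
    using sys unfolding eigensystem_def
    by (intro eq_matI) (auto simp: U_def V_def scalar_prod_def cinner_def atLeast0LessThan)
  then have VU: "V * U = 1\<^sub>m d"
    using mat_mult_left_right_inverse[of U d V] by (auto simp: U_def V_def)
  have "(\<Sum>k<d. u k i * cnj (u k j)) = (if i = j then 1 else 0)" if "i < d" "j < d" for i j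
  proof -
    have "(\<Sum>k<d. u k i * cnj (u k j)) = (V * U) $$ (i, j)"
      using that by (simp add: U_def V_def scalar_prod_def atLeast0LessThan)
    then show ?thesis using VU that by simp
  qed
  then show ?thesis using sys unfolding eigensystem_def eigenbasis_def by blast
qed

section \<open>Expansion in an eigenbasis\<close>

lemma eigenbasis_apply: "eigenbasis d H lam u \<Longrightarrow> k < d \<Longrightarrow> i < d \<Longrightarrow> mapply d H (u k) i = of_real (lam k) * u k i"
  unfolding eigenbasis_def by blast

lemma eigenbasis_orthonormal:
  "eigenbasis d H lam u \<Longrightarrow> k < d \<Longrightarrow> l < d \<Longrightarrow> cinner d (u k) (u l) = (if k = l then 1 else 0)"
  unfolding eigenbasis_def by blast

lemma eigenbasis_complete:
  "eigenbasis d H lam u \<Longrightarrow> i < d \<Longrightarrow> j < d \<Longrightarrow> (\<Sum>k<d. u k i * cnj (u k j)) = (if i = j then 1 else 0)"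
  unfolding eigenbasis_def by blast

lemma sqnorm_eigenbasis: "eigenbasis d H lam u \<Longrightarrow> k < d \<Longrightarrow> sqnorm d (u k) = 1"
  using eigenbasis_orthonormal[of d H lam u k k] by (simp add: cinner_self)

lemma cinner_expand:
  assumes "eigenbasis d H lam u"
  shows "cinner d x y = (\<Sum>k<d. cinner d x (u k) * cinner d (u k) y)"
proof -
  have "(\<Sum>k<d. cinner d x (u k) * cinner d (u k) y)
      = (\<Sum>k<d. \<Sum>i<d. \<Sum>j<d. cnj (x i) * y j * (u k i * cnj (u k j)))"
    unfolding cinner_def sum_product by (simp add: algebra_simps)
  also have "\<dots> = (\<Sum>i<d. \<Sum>j<d. \<Sum>k<d. cnj (x i) * y j * (u k i * cnj (u k j)))"
    by (subst sum.swap, rule sum.cong[OF refl], rule sum.swap)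
  also have "\<dots> = (\<Sum>i<d. \<Sum>j<d. if i = j then cnj (x i) * y j else 0)"
    unfolding sum_distrib_left[symmetric] using eigenbasis_complete[OF assms]
    by (intro sum.cong refl) simp
  finally show ?thesis by (simp add: cinner_def)
qed

lemma parseval:
  assumes "eigenbasis d H lam u"
  shows "(\<Sum>k<d. (cmod (cinner d (u k) x))\<^sup>2) = sqnorm d x"
proof -
  have "complex_of_real (sqnorm d x) = (\<Sum>k<d. cinner d x (u k) * cinner d (u k) x)"
    using cinner_expand[OF assms, of x x] by (simp add: cinner_self)
  also have "\<dots> = (\<Sum>k<d. of_real ((cmod (cinner d (u k) x))\<^sup>2))"
    by (intro sum.cong refl, subst cinner_commute) (metis complex_norm_square mult.commute of_real_power)
  finally show ?thesis by (metis of_real_eq_iff of_real_sum)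
qed

section \<open>Trace of the matrix exponential\<close>

primrec mpow :: "nat \<Rightarrow> (nat \<Rightarrow> nat \<Rightarrow> complex) \<Rightarrow> nat \<Rightarrow> nat \<Rightarrow> nat \<Rightarrow> complex" where
  "mpow d H 0 = (\<lambda>i j. if i = j then 1 else 0)"
| "mpow d H (Suc r) = (\<lambda>i j. \<Sum>l<d. H i l * mpow d H r l j)"

text \<open>The power series makes each entry a limit of polynomials in the entries of
  \<open>H\<close>, so measurability in a parameter is immediate. The spectral formula would depend
  on a choice of eigenbasis, which need not be measurable.\<close>

definition mexp :: "nat \<Rightarrow> real \<Rightarrow> (nat \<Rightarrow> nat \<Rightarrow> complex) \<Rightarrow> nat \<Rightarrow> nat \<Rightarrow> complex" where
  "mexp d t H i j = (\<Sum>r. of_real (t ^ r / fact r) * mpow d H r i j)"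

text \<open>The trace of the matrix product \<open>A B\<close>.\<close>

definition mtrprod :: "nat \<Rightarrow> (nat \<Rightarrow> nat \<Rightarrow> complex) \<Rightarrow> (nat \<Rightarrow> nat \<Rightarrow> complex) \<Rightarrow> complex" where
  "mtrprod d A B = (\<Sum>i<d. \<Sum>j<d. A i j * B j i)"

lemma norm_mpow_le:
  assumes "\<And>i j. i < d \<Longrightarrow> j < d \<Longrightarrow> cmod (H i j) \<le> b" "b \<ge> 0" "i < d" "j < d"
  shows "cmod (mpow d H r i j) \<le> (real d * b) ^ r"
  using assms(3)
proof (induction r arbitrary: i)
  case 0
  show ?case by simp
next
  case (Suc r)
  have "cmod (mpow d H (Suc r) i j) \<le> (\<Sum>l<d. cmod (H i l * mpow d H r l j))"
    by (simp add: norm_sum)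
  also have "\<dots> \<le> (\<Sum>l<d. b * (real d * b) ^ r)"
    using Suc assms by (intro sum_mono) (auto simp: norm_mult intro!: mult_mono)
  finally show ?case by (simp add: algebra_simps)
qed

lemma norm_mexp_le:
  assumes "\<And>i j. i < d \<Longrightarrow> j < d \<Longrightarrow> cmod (H i j) \<le> b" "b \<ge> 0" "i < d" "j < d"
  shows "cmod (mexp d t H i j) \<le> exp (\<bar>t\<bar> * (real d * b))"
proof -
  have le: "norm (of_real (t ^ r / fact r) * mpow d H r i j) \<le> (\<bar>t\<bar> * (real d * b)) ^ r /\<^sub>R fact r" for r
  proof -
    have "norm (of_real (t ^ r / fact r) * mpow d H r i j) \<le> \<bar>t\<bar> ^ r / fact r * (real d * b) ^ r"
      unfolding norm_mult using norm_mpow_le[OF assms, where r = r]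
      by (intro mult_mono) (auto simp: power_abs norm_divide norm_power)
    then show ?thesis by (simp add: power_mult_distrib divide_inverse mult_ac)
  qed
  have s: "(\<lambda>r. (\<bar>t\<bar> * (real d * b)) ^ r /\<^sub>R fact r) sums exp (\<bar>t\<bar> * (real d * b))"
    by (rule exp_converges)
  have "norm (suminf (\<lambda>r. of_real (t ^ r / fact r) * mpow d H r i j)) \<le> (\<Sum>r. (\<bar>t\<bar> * (real d * b)) ^ r /\<^sub>R fact r)"
    by (rule norm_suminf_le[OF le sums_summable[OF s]])
  then show ?thesis unfolding mexp_def using sums_unique[OF s] by simp
qed

lemma mpow_eigenbasis:
  assumes "eigenbasis d H lam u" "i < d" "j < d"
  shows "mpow d H r i j = (\<Sum>k<d. of_real (lam k ^ r) * u k i * cnj (u k j))"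
  using assms(2)
proof (induction r arbitrary: i)
  case 0
  then show ?case using eigenbasis_complete[OF assms(1) _ assms(3)] by simp
next
  case (Suc r)
  have "mpow d H (Suc r) i j = (\<Sum>l<d. \<Sum>k<d. H i l * (of_real (lam k ^ r) * u k l * cnj (u k j)))"
    using Suc by (simp add: sum_distrib_left)
  also have "\<dots> = (\<Sum>k<d. \<Sum>l<d. H i l * (of_real (lam k ^ r) * u k l * cnj (u k j)))"
    by (rule sum.swap)
  also have "\<dots> = (\<Sum>k<d. of_real (lam k ^ r) * mapply d H (u k) i * cnj (u k j))"
    unfolding mapply_def sum_distrib_left sum_distrib_right by (simp add: algebra_simps)
  also have "\<dots> = (\<Sum>k<d. of_real (lam k ^ Suc r) * u k i * cnj (u k j))"
    using eigenbasis_apply[OF assms(1) _ Suc.prems] by (intro sum.cong refl) simp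
  finally show ?case .
qed

lemma mexp_eigenbasis:
  assumes "eigenbasis d H lam u" "i < d" "j < d"
  shows "mexp d t H i j = (\<Sum>k<d. of_real (exp (t * lam k)) * u k i * cnj (u k j))"
proof -
  have "(\<lambda>r. (t * lam k) ^ r /\<^sub>R fact r) sums exp (t * lam k)" for k
    by (rule exp_converges)
  then have "(\<lambda>r. of_real ((t * lam k) ^ r /\<^sub>R fact r) * (u k i * cnj (u k j)))
      sums (of_real (exp (t * lam k)) * (u k i * cnj (u k j)))" for k
    by (intro sums_mult2) (simp only: sums_of_real_iff)
  then have "(\<lambda>r. \<Sum>k<d. of_real ((t * lam k) ^ r /\<^sub>R fact r) * (u k i * cnj (u k j)))
      sums (\<Sum>k<d. of_real (exp (t * lam k)) * (u k i * cnj (u k j)))"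
    by (intro sums_sum)
  moreover have "(\<Sum>k<d. of_real ((t * lam k) ^ r /\<^sub>R fact r) * (u k i * cnj (u k j)))
      = of_real (t ^ r / fact r) * mpow d H r i j" for r
    unfolding mpow_eigenbasis[OF assms] sum_distrib_left
    by (intro sum.cong refl) (simp add: power_mult_distrib field_simps scaleR_conv_of_real)
  ultimately show ?thesis
    unfolding mexp_def by (simp add: sums_iff mult.assoc)
qed

text \<open>The trace becomes a sum of quadratic forms of \<open>C\<close> with positive weights, so
  inequalities between quadratic forms pass to traces against the exponential.\<close>

lemma mtrprod_mexp:
  assumes "eigenbasis d H lam u"
  shows "mtrprod d C (mexp d t H) = (\<Sum>k<d. of_real (exp (t * lam k)) * cinner d (u k) (mapply d C (u k)))"
proof -
  have "mtrprod d C (mexp d t H)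
      = (\<Sum>i<d. \<Sum>j<d. \<Sum>k<d. of_real (exp (t * lam k)) * (cnj (u k i) * (C i j * u k j)))"
    unfolding mtrprod_def using mexp_eigenbasis[OF assms]
    by (intro sum.cong refl) (simp add: sum_distrib_left algebra_simps)
  also have "\<dots> = (\<Sum>i<d. \<Sum>k<d. \<Sum>j<d. of_real (exp (t * lam k)) * (cnj (u k i) * (C i j * u k j)))"
    by (rule sum.cong[OF refl], rule sum.swap)
  also have "\<dots> = (\<Sum>k<d. \<Sum>i<d. \<Sum>j<d. of_real (exp (t * lam k)) * (cnj (u k i) * (C i j * u k j)))"
    by (rule sum.swap)
  finally show ?thesis
    by (simp add: cinner_def mapply_def sum_distrib_left)
qed

lemma trace_mexp:
  assumes "eigenbasis d H lam u"
  shows "(\<Sum>i<d. mexp d t H i i) = of_real (\<Sum>k<d. exp (t * lam k))"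
proof -
  have "(\<Sum>i<d. mexp d t H i i) = (\<Sum>i<d. \<Sum>k<d. of_real (exp (t * lam k)) * (cnj (u k i) * u k i))"
    using mexp_eigenbasis[OF assms] by (intro sum.cong refl) (simp add: mult_ac)
  also have "\<dots> = (\<Sum>k<d. of_real (exp (t * lam k)) * cinner d (u k) (u k))"
    by (subst sum.swap) (simp add: cinner_def sum_distrib_left)
  finally show ?thesis using eigenbasis_orthonormal[OF assms] by simp
qed

lemma mtrprod_self_mexp:
  assumes "eigenbasis d H lam u"
  shows "mtrprod d H (mexp d t H) = of_real (\<Sum>k<d. lam k * exp (t * lam k))"
proof -
  have "cinner d (u k) (mapply d H (u k)) = of_real (lam k)" if "k < d" for k
  proof -
    have "cinner d (u k) (mapply d H (u k)) = cinner d (u k) (\<lambda>i. of_real (lam k) * u k i)"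
      using eigenbasis_apply[OF assms that] by (intro cinner_cong) auto
    then show ?thesis
      using eigenbasis_orthonormal[OF assms that that] by (simp add: cinner_smult_right)
  qed
  then show ?thesis unfolding mtrprod_mexp[OF assms] of_real_sum
    by (intro sum.cong refl) simp
qed

text \<open>For \<open>y \<le> x\<close>, the inequality \<open>1 + z \<le> exp z\<close> at
  \<open>z = y - x\<close> gives the bound with \<open>exp x\<close> alone. Adding
  \<open>exp y\<close> makes it symmetric, so that it later splits into one part per
  exponential.\<close>

lemma abs_exp_diff_le: "\<bar>exp x - exp y\<bar> \<le> \<bar>x - y\<bar> * (exp x + exp (y::real))"
proof -
  have *: "exp x - exp y \<le> (x - y) * (exp x + exp y)" if "y \<le> x" for x y :: real
  proof -
    have "exp x * (1 + (y - x)) \<le> exp x * exp (y - x)"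
      by (intro mult_left_mono exp_ge_add_one_self) auto
    also have "\<dots> = exp y" by (simp flip: exp_add)
    finally have "exp x - exp y \<le> (x - y) * exp x" by (simp add: algebra_simps)
    also have "\<dots> \<le> (x - y) * (exp x + exp y)" using that by (intro mult_left_mono) auto
    finally show ?thesis .
  qed
  show ?thesis
    using *[of y x] *[of x y] by (cases "y \<le> x") (auto simp: abs_if add.commute)
qed

text \<open>In the eigenbases \<open>u\<close> of \<open>A\<close> and \<open>v\<close> of \<open>B\<close> the matrix \<open>exp A - exp B\<close> has the
  entries of \<open>A - B\<close> multiplied by divided differences of the exponential.\<close>

lemma exp_mean_value_trace:
  assumes A: "hermitian_fun d A" and B: "hermitian_fun d B" and C: "hermitian_fun d C"
    and t: "t \<ge> 0"
    and SC: "\<And>v. sqnorm d (mapply d C v) \<le> Re (cinner d v (mapply d S v))"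
    and SAB: "\<And>v. sqnorm d (mapply d (\<lambda>i j. A i j - B i j) v) \<le> Re (cinner d v (mapply d S v))"
  shows "Re (mtrprod d C (mexp d t A)) - Re (mtrprod d C (mexp d t B))
    \<le> t * (Re (mtrprod d S (mexp d t A)) + Re (mtrprod d S (mexp d t B)))"
proof -
  obtain a u where u: "eigenbasis d A a u" using hermitian_eigenbasis_exists[OF A] by blast
  obtain b v where v: "eigenbasis d B b v" using hermitian_eigenbasis_exists[OF B] by blast
  define E where "E = (\<lambda>i j. A i j - B i j)"
  have E: "hermitian_fun d E"
    using A B unfolding hermitian_fun_def E_def by (metis complex_cnj_diff)
  define w where "w j k = cinner d (u j) (v k)" for j k
  define c where "c k j = cinner d (v k) (mapply d C (u j))" for k j
  define D where "D j k = cinner d (u j) (mapply d E (v k))" for j k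
  \<comment> \<open>\<open>A\<close> acts to the left and \<open>B\<close> to the right. Keeping the
    overlap \<open>w j k\<close> as a factor avoids divided differences, which would need a separate
    case for \<open>a j = b k\<close>.\<close>
  have D: "D j k = of_real (a j - b k) * w j k" if "j < d" "k < d" for j k
  proof -
    have "D j k = cinner d (u j) (mapply d A (v k)) - cinner d (u j) (mapply d B (v k))"
      unfolding D_def E_def mapply_def cinner_def
      by (simp add: algebra_simps sum_subtractf)
    also have "cinner d (u j) (mapply d A (v k)) = cinner d (\<lambda>i. of_real (a j) * u j i) (v k)"
      unfolding cinner_mapply_hermitian[OF A]
      using eigenbasis_apply[OF u that(1)] by (intro cinner_cong) auto
    also have "cinner d (u j) (mapply d B (v k)) = cinner d (u j) (\<lambda>i. of_real (b k) * v k i)"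
      using eigenbasis_apply[OF v that(2)] by (intro cinner_cong) auto
    finally show ?thesis
      unfolding cinner_smult_left cinner_smult_right w_def by (simp add: algebra_simps)
  qed
  \<comment> \<open>Both traces are expanded over the same pairs of eigenvectors, so their
    difference carries the factor \<open>exp (t * a j) - exp (t * b k)\<close>.\<close>
  have trA: "mtrprod d C (mexp d t A) = (\<Sum>j<d. \<Sum>k<d. of_real (exp (t * a j)) * (w j k * c k j))"
    unfolding mtrprod_mexp[OF u] c_def w_def
    by (intro sum.cong refl, subst cinner_expand[OF v]) (simp add: sum_distrib_left)
  have "mtrprod d C (mexp d t B) = (\<Sum>k<d. \<Sum>j<d. of_real (exp (t * b k)) * (w j k * c k j))"
    unfolding mtrprod_mexp[OF v] c_def w_def cinner_mapply_hermitian[OF C]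
    by (intro sum.cong refl, subst cinner_expand[OF u]) (simp add: sum_distrib_left mult_ac)
  also have "\<dots> = (\<Sum>j<d. \<Sum>k<d. of_real (exp (t * b k)) * (w j k * c k j))"
    by (rule sum.swap)
  finally have trB: "mtrprod d C (mexp d t B) = \<dots>" .
  have "Re (mtrprod d C (mexp d t A)) - Re (mtrprod d C (mexp d t B))
      = (\<Sum>j<d. \<Sum>k<d. Re (of_real (exp (t * a j) - exp (t * b k)) * (w j k * c k j)))"
    unfolding trA trB by (simp add: sum_subtractf algebra_simps)
  also have "\<dots> \<le> (\<Sum>j<d. \<Sum>k<d. t / 2 * (exp (t * a j) * ((cmod (D j k))\<^sup>2 + (cmod (c k j))\<^sup>2))
      + t / 2 * (exp (t * b k) * ((cmod (D j k))\<^sup>2 + (cmod (c k j))\<^sup>2)))"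
  proof (intro sum_mono)
    fix j k assume "j \<in> {..<d}" "k \<in> {..<d}"
    then have jk: "j < d" "k < d" by auto
    have "Re (of_real (exp (t * a j) - exp (t * b k)) * (w j k * c k j))
        \<le> cmod (of_real (exp (t * a j) - exp (t * b k)) * (w j k * c k j))"
      by (rule complex_Re_le_cmod)
    also have "\<dots> = \<bar>exp (t * a j) - exp (t * b k)\<bar> * (cmod (w j k) * cmod (c k j))"
      by (simp only: norm_mult norm_of_real)
    also have "\<dots> \<le> (\<bar>t * a j - t * b k\<bar> * (exp (t * a j) + exp (t * b k))) * (cmod (w j k) * cmod (c k j))"
      by (intro mult_right_mono abs_exp_diff_le) auto
    also have "\<bar>t * a j - t * b k\<bar> = t * \<bar>a j - b k\<bar>"
      using t by (simp add: abs_mult flip: right_diff_distrib)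
    also have "t * \<bar>a j - b k\<bar> * (exp (t * a j) + exp (t * b k)) * (cmod (w j k) * cmod (c k j))
        = t * (exp (t * a j) + exp (t * b k)) * (cmod (D j k) * cmod (c k j))"
      unfolding D[OF jk] norm_mult norm_of_real by (simp add: mult_ac)
    \<comment> \<open>The arithmetic-geometric inequality separates \<open>E\<close> from
      \<open>C\<close>; equal weights are adequate because both squares are dominated by the same
      \<open>S\<close>.\<close>
    also have "\<dots> \<le> t * (exp (t * a j) + exp (t * b k)) * (((cmod (D j k))\<^sup>2 + (cmod (c k j))\<^sup>2) / 2)"
      using t sum_squares_bound[of "cmod (D j k)" "cmod (c k j)"]
      by (intro mult_left_mono) (auto intro!: mult_nonneg_nonneg add_nonneg_nonneg)
    finally show "Re (of_real (exp (t * a j) - exp (t * b k)) * (w j k * c k j))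
      \<le> t / 2 * (exp (t * a j) * ((cmod (D j k))\<^sup>2 + (cmod (c k j))\<^sup>2))
      + t / 2 * (exp (t * b k) * ((cmod (D j k))\<^sup>2 + (cmod (c k j))\<^sup>2))"
      by (simp add: algebra_simps)
  qed
  also have "\<dots> = t / 2 * (\<Sum>j<d. exp (t * a j) * ((\<Sum>k<d. (cmod (D j k))\<^sup>2) + (\<Sum>k<d. (cmod (c k j))\<^sup>2)))
      + t / 2 * (\<Sum>k<d. exp (t * b k) * ((\<Sum>j<d. (cmod (D j k))\<^sup>2) + (\<Sum>j<d. (cmod (c k j))\<^sup>2)))"
    unfolding sum.distrib sum_distrib_left sum_distrib_right distrib_left
    by (subst (3 4) sum.swap) simp
  \<comment> \<open>For each exponential the eigenbasis of the other matrix is summed out. Parseval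
    turns the squares into squared lengths of \<open>E\<close> and \<open>C\<close> applied to one
    vector, each at most the form of \<open>S\<close>; the resulting 2 cancels against
    \<open>t / 2\<close>.\<close>
  also have "\<dots> \<le> t / 2 * (\<Sum>j<d. exp (t * a j) * (2 * Re (cinner d (u j) (mapply d S (u j)))))
      + t / 2 * (\<Sum>k<d. exp (t * b k) * (2 * Re (cinner d (v k) (mapply d S (v k)))))"
  proof (intro add_mono mult_left_mono sum_mono)
    fix j
    have "cmod (D j k) = cmod (cinner d (v k) (mapply d E (u j)))" for k
      unfolding D_def cinner_mapply_hermitian[OF E]
      by (subst cinner_commute) (simp add: cinner_mapply_hermitian[OF E])
    then have "(\<Sum>k<d. (cmod (D j k))\<^sup>2) = sqnorm d (mapply d E (u j))"
      using parseval[OF v] by simp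
    moreover have "(\<Sum>k<d. (cmod (c k j))\<^sup>2) = sqnorm d (mapply d C (u j))"
      unfolding c_def by (rule parseval[OF v])
    ultimately show "(\<Sum>k<d. (cmod (D j k))\<^sup>2) + (\<Sum>k<d. (cmod (c k j))\<^sup>2)
        \<le> 2 * Re (cinner d (u j) (mapply d S (u j)))"
      using SC[of "u j"] SAB[of "u j"] unfolding E_def by simp
  next
    fix k
    have "cmod (c k j) = cmod (cinner d (u j) (mapply d C (v k)))" for j
      unfolding c_def cinner_mapply_hermitian[OF C]
      by (subst cinner_commute) (simp add: cinner_mapply_hermitian[OF C])
    then have "(\<Sum>j<d. (cmod (c k j))\<^sup>2) = sqnorm d (mapply d C (v k))"
      using parseval[OF u] by simp
    moreover have "(\<Sum>j<d. (cmod (D j k))\<^sup>2) = sqnorm d (mapply d E (v k))"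
      unfolding D_def by (rule parseval[OF u])
    ultimately show "(\<Sum>j<d. (cmod (D j k))\<^sup>2) + (\<Sum>j<d. (cmod (c k j))\<^sup>2)
        \<le> 2 * Re (cinner d (v k) (mapply d S (v k)))"
      using SC[of "v k"] SAB[of "v k"] unfolding E_def by simp
  qed (use t in auto)
  also have "\<dots> = t * (Re (mtrprod d S (mexp d t A)) + Re (mtrprod d S (mexp d t B)))"
    unfolding mtrprod_mexp[OF u] mtrprod_mexp[OF v]
    by (simp add: sum_distrib_left distrib_left mult_ac)
  finally show ?thesis .
qed

section \<open>Resampling coordinates of a product measure\<close>

text \<open>Jensen's inequality for the square, obtained from the nonnegative variance of
  \<open>cmod (f x)\<close>.\<close>

lemma (in prob_space) norm_integral_sq_le:
  fixes f :: "'a \<Rightarrow> complex"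
  assumes f [measurable]: "f \<in> borel_measurable M" and b: "\<And>x. x \<in> space M \<Longrightarrow> cmod (f x) \<le> b"
  shows "(cmod (\<integral>x. f x \<partial>M))\<^sup>2 \<le> (\<integral>x. (cmod (f x))\<^sup>2 \<partial>M)"
proof -
  have "0 \<le> b" using b not_empty norm_ge_zero order_trans by blast
  have 1: "integrable M (\<lambda>x. cmod (f x))"
    using b by (intro integrable_const_bound[where B = b]) auto
  have 2: "integrable M (\<lambda>x. (cmod (f x))\<^sup>2)"
    using b \<open>0 \<le> b\<close> by (intro integrable_const_bound[where B = "b\<^sup>2"]) (auto intro!: power_mono)
  have "(cmod (\<integral>x. f x \<partial>M))\<^sup>2 \<le> (\<integral>x. cmod (f x) \<partial>M)\<^sup>2"
    by (intro power_mono integral_norm_bound) auto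
  also have "\<dots> \<le> (\<integral>x. (cmod (f x))\<^sup>2 \<partial>M)"
    using variance_positive[of "\<lambda>x. cmod (f x)"] variance_eq[OF 1 2] by simp
  finally show ?thesis .
qed

lemma (in prob_space) integrable_bounded:
  fixes f :: "'a \<Rightarrow> 'b :: {banach, second_countable_topology}"
  assumes "f \<in> borel_measurable M" "\<And>x. x \<in> space M \<Longrightarrow> norm (f x) \<le> b"
  shows "integrable M f"
  using assms by (intro integrable_const_bound[where B = b]) auto

lemma (in prob_space) norm_expectation_le:
  fixes f :: "'a \<Rightarrow> 'b :: {banach, second_countable_topology}"
  assumes "f \<in> borel_measurable M" "\<And>x. x \<in> space M \<Longrightarrow> norm (f x) \<le> b"
  shows "norm (\<integral>x. f x \<partial>M) \<le> b"
proof -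
  have i: "integrable M f" using assms by (rule integrable_bounded)
  have "norm (\<integral>x. f x \<partial>M) \<le> (\<integral>x. norm (f x) \<partial>M)" by (rule integral_norm_bound)
  also have "\<dots> \<le> (\<integral>x. b \<partial>M)" using i assms by (intro integral_mono) auto
  finally show ?thesis by (simp add: prob_space)
qed

text \<open>The assumption covers every index, also those from \<open>n\<close> on, because
  \<open>product_prob_space\<close> asks for it; the application pads the family with point
  masses.\<close>

locale product_of_prob =
  fixes n :: nat and N :: "nat \<Rightarrow> 'b measure"
  assumes prob_N: "\<And>i. prob_space (N i)"
begin

abbreviation "P \<equiv> PiM {..<n} N"

sublocale factor: prob_space "N i" for i by (rule prob_N)
sublocale prod: product_prob_space N "{..<n}" by unfold_locales
sublocale PP: pair_prob_space P P by unfold_locales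

text \<open>With \<open>J = {..<k}\<close> the past is kept from \<open>x\<close> and the future
  renewed from \<open>y\<close>; with \<open>J = {k}\<close> a single coordinate of \<open>y\<close>
  is resampled from \<open>x\<close>.\<close>

definition mix :: "nat set \<Rightarrow> (nat \<Rightarrow> 'b) \<Rightarrow> (nat \<Rightarrow> 'b) \<Rightarrow> nat \<Rightarrow> 'b" where
  "mix J x y = (\<lambda>i\<in>{..<n}. if i \<in> J then x i else y i)"

lemma mix_apply [simp]: "i < n \<Longrightarrow> mix J x y i = (if i \<in> J then x i else y i)"
  by (simp add: mix_def)

lemma measurable_mix [measurable]: "(\<lambda>p. mix J (fst p) (snd p)) \<in> measurable (P \<Otimes>\<^sub>M P) P"
  unfolding mix_def
proof (rule measurable_restrict)
  fix i assume "i \<in> {..<n}"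
  then show "(\<lambda>p. if i \<in> J then fst p i else snd p i) \<in> measurable (P \<Otimes>\<^sub>M P) (N i)"
    by (cases "i \<in> J") auto
qed

lemma measurable_mix_Pair [measurable]:
  "f \<in> measurable K P \<Longrightarrow> g \<in> measurable K P \<Longrightarrow> (\<lambda>w. mix J (f w) (g w)) \<in> measurable K P"
  using measurable_compose[OF measurable_Pair[of f K P g P] measurable_mix] unfolding fst_conv snd_conv .

lemma space_mix: "x \<in> space P \<Longrightarrow> y \<in> space P \<Longrightarrow> mix J x y \<in> space P"
  unfolding space_PiM mix_def by (intro restrict_PiE_iff[THEN iffD2]) (simp add: PiE_iff)

lemma mix_eqI:
  assumes "w \<in> extensional {..<n}" "\<And>i. i < n \<Longrightarrow> (if i \<in> J then x i else y i) = w i"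
  shows "mix J x y = w"
  using assms by (intro extensionalityI[where A = "{..<n}"]) (simp_all add: mix_def)

lemma space_P_extensional: "x \<in> space P \<Longrightarrow> x \<in> extensional {..<n}"
  by (simp add: space_PiM PiE_iff)

lemma mix_all: "x \<in> space P \<Longrightarrow> mix {..<n} x y = x"
  by (intro mix_eqI space_P_extensional) simp_all

lemma mix_none: "y \<in> space P \<Longrightarrow> mix {} x y = y"
  by (intro mix_eqI space_P_extensional) simp_all

lemma mix_single_eq_upd:
  assumes "x \<in> space P" "k < n"
  shows "mix {k} z x = x(k := z k)"
proof (rule mix_eqI)
  show "x(k := z k) \<in> extensional {..<n}"
    using space_P_extensional[OF assms(1)] assms(2) by (simp add: extensional_def)
qed simp

text \<open>Choosing each coordinate from one of two independent copies, by a rule that ignores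
  their values, leaves the product law unchanged. It is enough to check this on boxes.\<close>

lemma distr_mix: "distr (P \<Otimes>\<^sub>M P) P (\<lambda>p. mix J (fst p) (snd p)) = P"
proof (rule prod.PiM_eqI)
  fix A assume A: "\<And>i. i \<in> {..<n} \<Longrightarrow> A i \<in> sets (N i)"
  \<comment> \<open>A box condition on the mixed point splits into \<open>B\<close>, which restricts
    the first copy on \<open>J\<close>, and \<open>C\<close>, which restricts the second copy off
    \<open>J\<close>. For each \<open>i\<close> the other factor has mass 1.\<close>
  define B where "B i = (if i \<in> J then A i else space (N i))" for i
  define C where "C i = (if i \<in> J then space (N i) else A i)" for i
  have sub: "A i \<subseteq> space (N i)" if "i < n" for i
    using A[of i] that sets.sets_into_space by blast
  have eq: "(\<lambda>p. mix J (fst p) (snd p)) -` Pi\<^sub>E {..<n} A \<inter> space (P \<Otimes>\<^sub>M P)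
      = Pi\<^sub>E {..<n} B \<times> Pi\<^sub>E {..<n} C"
  proof (intro equalityI subsetI)
    fix p assume "p \<in> (\<lambda>p. mix J (fst p) (snd p)) -` Pi\<^sub>E {..<n} A \<inter> space (P \<Otimes>\<^sub>M P)"
    then have m: "mix J (fst p) (snd p) \<in> Pi\<^sub>E {..<n} A"
      and p: "fst p \<in> space P" "snd p \<in> space P"
      unfolding Int_iff vimage_eq space_pair_measure mem_Times_iff by blast+
    have h: "(if i \<in> J then fst p i else snd p i) \<in> A i" if "i < n" for i
      using PiE_mem[OF m, of i] that by simp
    have "fst p i \<in> B i" "snd p i \<in> C i" if "i < n" for i
      using h[OF that] that PiE_mem[OF p(1)[unfolded space_PiM], of i] PiE_mem[OF p(2)[unfolded space_PiM], of i]
      unfolding B_def C_def by (auto split: if_splits)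
    then have "fst p \<in> Pi\<^sub>E {..<n} B" "snd p \<in> Pi\<^sub>E {..<n} C"
      using p unfolding space_PiM PiE_iff by auto
    then show "p \<in> Pi\<^sub>E {..<n} B \<times> Pi\<^sub>E {..<n} C" unfolding mem_Times_iff by blast
  next
    fix p assume "p \<in> Pi\<^sub>E {..<n} B \<times> Pi\<^sub>E {..<n} C"
    then have p: "fst p \<in> Pi\<^sub>E {..<n} B" "snd p \<in> Pi\<^sub>E {..<n} C"
      unfolding mem_Times_iff by blast+
    have "(if i \<in> J then fst p i else snd p i) \<in> A i" if "i < n" for i
      using PiE_mem[OF p(1), of i] PiE_mem[OF p(2), of i] that by (auto simp: B_def C_def)
    then have "mix J (fst p) (snd p) \<in> Pi\<^sub>E {..<n} A" unfolding mix_def by (intro restrict_PiE_iff[THEN iffD2]) simp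
    moreover have "Pi\<^sub>E {..<n} B \<subseteq> space P" "Pi\<^sub>E {..<n} C \<subseteq> space P"
      unfolding space_PiM B_def C_def using sub by (intro PiE_mono; simp)+
    ultimately show "p \<in> (\<lambda>p. mix J (fst p) (snd p)) -` Pi\<^sub>E {..<n} A \<inter> space (P \<Otimes>\<^sub>M P)"
      using p unfolding Int_iff vimage_eq space_pair_measure mem_Times_iff by blast
  qed
  have B: "B i \<in> sets (N i)" and C: "C i \<in> sets (N i)" if "i < n" for i
    using A[of i] that by (auto simp: B_def C_def)
  have "emeasure (distr (P \<Otimes>\<^sub>M P) P (\<lambda>p. mix J (fst p) (snd p))) (Pi\<^sub>E {..<n} A)
      = emeasure (P \<Otimes>\<^sub>M P) (Pi\<^sub>E {..<n} B \<times> Pi\<^sub>E {..<n} C)"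
    using A by (subst emeasure_distr) (auto simp: eq intro!: sets_PiM_I_finite)
  also have "\<dots> = emeasure P (Pi\<^sub>E {..<n} B) * emeasure P (Pi\<^sub>E {..<n} C)"
    using B C by (intro sigma_finite_measure.emeasure_pair_measure_Times sets_PiM_I_finite
        prob_space_imp_sigma_finite prob_space_PiM prob_N) auto
  also have "\<dots> = (\<Prod>i<n. emeasure (N i) (B i)) * (\<Prod>i<n. emeasure (N i) (C i))"
    using prod.emeasure_PiM[OF finite_lessThan, of n B] prod.emeasure_PiM[OF finite_lessThan, of n C] B C
    by simp
  also have "\<dots> = (\<Prod>i<n. emeasure (N i) (A i))"
    unfolding prod.distrib[symmetric]
    by (intro prod.cong refl) (auto simp: B_def C_def factor.emeasure_space_1)
  finally show "emeasure (distr (P \<Otimes>\<^sub>M P) P (\<lambda>p. mix J (fst p) (snd p))) (Pi\<^sub>E {..<n} A)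
      = (\<Prod>i<n. emeasure (N i) (A i))" .
qed simp_all

text \<open>Fubini in either order. This serves as the tower property for conditional expectations
  and as the equality in law of a point and its resampled version.\<close>

lemma integral_mix:
  fixes f :: "(nat \<Rightarrow> 'b) \<Rightarrow> 'c :: {banach, second_countable_topology}"
  assumes f [measurable]: "f \<in> borel_measurable P" and b: "\<And>x. x \<in> space P \<Longrightarrow> norm (f x) \<le> b"
  shows "(\<integral>x. (\<integral>y. f (mix J x y) \<partial>P) \<partial>P) = (\<integral>x. f x \<partial>P)"
    and "(\<integral>y. (\<integral>x. f (mix J x y) \<partial>P) \<partial>P) = (\<integral>x. f x \<partial>P)"
proof -
  have int: "integrable (P \<Otimes>\<^sub>M P) (\<lambda>p. f (mix J (fst p) (snd p)))"
    by (intro PP.integrable_bounded[where b = b]) (auto simp: space_pair_measure intro!: b space_mix)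
  have "(\<integral>x. f x \<partial>P) = (\<integral>x. f x \<partial>distr (P \<Otimes>\<^sub>M P) P (\<lambda>p. mix J (fst p) (snd p)))"
    by (simp add: distr_mix)
  also have "\<dots> = (\<integral>p. f (mix J (fst p) (snd p)) \<partial>(P \<Otimes>\<^sub>M P))"
    by (rule integral_distr) measurable
  finally have eq: "(\<integral>x. f x \<partial>P) = \<dots>" .
  show "(\<integral>x. (\<integral>y. f (mix J x y) \<partial>P) \<partial>P) = (\<integral>x. f x \<partial>P)"
    unfolding eq using PP.integral_fst'[OF int] by simp
  show "(\<integral>y. (\<integral>x. f (mix J x y) \<partial>P) \<partial>P) = (\<integral>x. f x \<partial>P)"
    unfolding eq using PP.integral_snd[of "\<lambda>x y. f (mix J x y)"] int by (simp add: case_prod_unfold)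
qed

end

section \<open>Eigenvalues, trace products and measurability\<close>

lemma mapply_sum_matrix: "mapply d (\<lambda>i j. \<Sum>k\<in>K. A k i j) v i = (\<Sum>k\<in>K. mapply d (A k) v i)"
  unfolding mapply_def sum_distrib_right by (rule sum.swap)

text \<open>By Parseval some coefficient of \<open>v\<close> is nonzero, and pairing the eigenvalue
  equation with that basis vector identifies \<open>c\<close>.\<close>

lemma eigenvalue_in_eigenbasis:
  assumes eb: "eigenbasis d H lam u" and H: "hermitian_fun d H"
    and ev: "\<And>i. i < d \<Longrightarrow> mapply d H v i = c * v i" and v: "\<exists>i<d. v i \<noteq> 0"
  shows "\<exists>k<d. c = of_real (lam k)"
proof -
  have "\<exists>k<d. cinner d (u k) v \<noteq> 0"
  proof (rule ccontr)
    assume "\<not> ?thesis"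
    then have "sqnorm d v = 0" using parseval[OF eb, of v] by simp
    then show False using v sqnorm_eq_0_iff by blast
  qed
  then obtain k where k: "k < d" "cinner d (u k) v \<noteq> 0" by blast
  have "c * cinner d (u k) v = cinner d (u k) (mapply d H v)"
    using ev by (subst cinner_smult_right[symmetric]) (intro cinner_cong, auto)
  also have "\<dots> = cinner d (\<lambda>i. of_real (lam k) * u k i) v"
    unfolding cinner_mapply_hermitian[OF H]
    using eigenbasis_apply[OF eb k(1)] by (intro cinner_cong) auto
  finally show ?thesis using k by (auto simp: cinner_smult_left)
qed

lemma mtrprod_sum_left: "mtrprod d (\<lambda>i j. \<Sum>k\<in>K. A k i j) B = (\<Sum>k\<in>K. mtrprod d (A k) B)"
  unfolding mtrprod_def sum_distrib_right
  by (subst sum.swap, rule sum.cong[OF refl], rule sum.swap) 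

lemma mtrprod_cong:
  "(\<And>i j. i < d \<Longrightarrow> j < d \<Longrightarrow> A i j = A' i j) \<Longrightarrow> (\<And>i j. i < d \<Longrightarrow> j < d \<Longrightarrow> B i j = B' i j) \<Longrightarrow>
    mtrprod d A B = mtrprod d A' B'"
  unfolding mtrprod_def by (intro sum.cong refl) auto

lemma mapply_cong:
  "(\<And>i j. i < d \<Longrightarrow> j < d \<Longrightarrow> A i j = A' i j) \<Longrightarrow> i < d \<Longrightarrow> mapply d A v i = mapply d A' v i"
  unfolding mapply_def by (intro sum.cong refl) auto

lemma norm_mtrprod_le:
  assumes "\<And>i j. i < d \<Longrightarrow> j < d \<Longrightarrow> cmod (A i j) \<le> a" "\<And>i j. i < d \<Longrightarrow> j < d \<Longrightarrow> cmod (B i j) \<le> b"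
    "a \<ge> 0"
  shows "cmod (mtrprod d A B) \<le> real d * (real d * (a * b))"
proof -
  have "cmod (mtrprod d A B) \<le> (\<Sum>i<d. \<Sum>j<d. a * b)"
    unfolding mtrprod_def using assms
    by (intro order_trans[OF norm_sum] sum_mono) (auto simp: norm_mult intro!: mult_mono)
  then show ?thesis by simp
qed

lemma borel_measurable_mpow:
  assumes "\<And>i j. i < d \<Longrightarrow> j < d \<Longrightarrow> (\<lambda>x. H x i j) \<in> borel_measurable M" "i < d" "j < d"
  shows "(\<lambda>x. mpow d (H x) r i j) \<in> borel_measurable M"
  using assms(2)
proof (induction r arbitrary: i)
  case 0
  show ?case by simp
next
  case (Suc r)
  then show ?case using assms by (auto intro!: borel_measurable_sum borel_measurable_times)
qed

lemma borel_measurable_mexp: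
  assumes "\<And>i j. i < d \<Longrightarrow> j < d \<Longrightarrow> (\<lambda>x. H x i j) \<in> borel_measurable M" "i < d" "j < d"
  shows "(\<lambda>x. mexp d t (H x) i j) \<in> borel_measurable M"
  unfolding mexp_def
  by (intro borel_measurable_suminf borel_measurable_times borel_measurable_const borel_measurable_mpow assms)

lemma borel_measurable_mtrprod:
  assumes "\<And>i j. i < d \<Longrightarrow> j < d \<Longrightarrow> (\<lambda>x. A x i j) \<in> borel_measurable M"
    "\<And>i j. i < d \<Longrightarrow> j < d \<Longrightarrow> (\<lambda>x. B x i j) \<in> borel_measurable M"
  shows "(\<lambda>x. mtrprod d (A x) (B x)) \<in> borel_measurable M"
  unfolding mtrprod_def using assms by (intro borel_measurable_sum borel_measurable_times) auto

section \<open>Matrix bounded differences\<close>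

text \<open>In the application \<open>G\<close> is the block circulant matrix of \<open>F\<close>,
  \<open>S k\<close> that of the squared k-th bound, and \<open>s\<close> is
  \<open>\<sigma>^2\<close>. The semidefinite order enters through quadratic forms only.\<close>

locale matrix_bounded_differences = product_of_prob n N
  for n :: nat and N :: "nat \<Rightarrow> 'b measure" +
  fixes d :: nat and G :: "(nat \<Rightarrow> 'b) \<Rightarrow> nat \<Rightarrow> nat \<Rightarrow> complex"
    and S :: "nat \<Rightarrow> nat \<Rightarrow> nat \<Rightarrow> complex" and s :: real
  assumes G_measurable: "\<And>i j. i < d \<Longrightarrow> j < d \<Longrightarrow> (\<lambda>x. G x i j) \<in> borel_measurable P"
    and G_hermitian: "\<And>x. x \<in> space P \<Longrightarrow> hermitian_fun d (G x)"
    and G_diff: "\<And>k x y v. k < n \<Longrightarrow> x \<in> space P \<Longrightarrow> y \<in> space (N k) \<Longrightarrow>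
      sqnorm d (mapply d (\<lambda>i j. G x i j - G (x(k := y)) i j) v) \<le> Re (cinner d v (mapply d (S k) v))"
    and S_sum: "\<And>v. (\<Sum>k<n. Re (cinner d v (mapply d (S k) v))) \<le> s * sqnorm d v"
    and s_nonneg: "s \<ge> 0"
begin

section \<open>Boundedness of the matrix function\<close>

lemma not_empty_P: "\<exists>x. x \<in> space P"
  using prod.not_empty by blast

lemma measure_space_P: "measure P (space P) = 1"
  by (intro prob_space.prob_space prob_space_PiM prob_N)

lemma space_nth: "x \<in> space P \<Longrightarrow> k < n \<Longrightarrow> x k \<in> space (N k)"
  by (auto simp: space_PiM PiE_iff)

lemma S_nonneg: "k < n \<Longrightarrow> 0 \<le> Re (cinner d v (mapply d (S k) v))"
proof -
  assume k: "k < n"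
  obtain x where x: "x \<in> space P" using not_empty_P by blast
  show ?thesis using G_diff[OF k x space_nth[OF x k], of v] sqnorm_nonneg order_trans by blast
qed

lemma S_le: "k < n \<Longrightarrow> Re (cinner d v (mapply d (S k) v)) \<le> s * sqnorm d v"
  using S_sum[of v] member_le_sum[of k "{..<n}" "\<lambda>k. Re (cinner d v (mapply d (S k) v))"] S_nonneg
  by force

lemma entry_diff_le:
  assumes "k < n" "x \<in> space P" "y \<in> space (N k)" "i < d" "j < d"
  shows "cmod (G x i j - G (x(k := y)) i j) \<le> sqrt s"
proof -
  \<comment> \<open>Testing with the standard basis vector \<open>e\<close> at \<open>j\<close>
    picks out a column, whose squared length bounds each of its squared entries.\<close>
  define e where "e = (\<lambda>l. if l = j then 1 else 0 :: complex)"
  have "sqnorm d e = (\<Sum>l<d. if l = j then 1 else 0)"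
    unfolding sqnorm_def e_def by (intro sum.cong refl) auto
  then have e: "sqnorm d e = 1" using assms by simp
  have E: "mapply d E e i = E i j" for E
    unfolding mapply_def e_def using assms by (simp add: if_distrib cong: if_cong)
  have "(cmod (G x i j - G (x(k := y)) i j))\<^sup>2
      \<le> sqnorm d (mapply d (\<lambda>i j. G x i j - G (x(k := y)) i j) e)"
    unfolding sqnorm_def
    using member_le_sum[of i "{..<d}" "\<lambda>i. (cmod (mapply d (\<lambda>i j. G x i j - G (x(k := y)) i j) e i))\<^sup>2"] assms E
    by simp
  also have "\<dots> \<le> s" using G_diff[OF assms(1-3), of e] S_le[OF assms(1), of e] e by simp
  finally show ?thesis by (rule real_le_rsqrt)
qed

lemma mix_Suc_upd:
  assumes "x \<in> space P" "y \<in> space P" "k < n"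
  shows "mix {..<k} x y = (mix {..<Suc k} x y)(k := y k)"
proof (rule mix_eqI)
  show "(mix {..<Suc k} x y)(k := y k) \<in> extensional {..<n}"
    using space_P_extensional[OF space_mix[OF assms(1,2)]] assms(3) by (simp add: extensional_def)
qed simp

text \<open>Starting at a fixed reference point, the coordinates are replaced one at a time, and
  each replacement moves an entry by at most \<open>sqrt s\<close>. All later integrability rests on
  this bound.\<close>

lemma G_bounded: "\<exists>b\<ge>0. \<forall>x\<in>space P. \<forall>i<d. \<forall>j<d. cmod (G x i j) \<le> b"
proof -
  obtain x0 where x0: "x0 \<in> space P" using not_empty_P by blast
  have *: "cmod (G (mix {..<k} x x0) i j - G x0 i j) \<le> real k * sqrt s"
    if x: "x \<in> space P" and ij: "i < d" "j < d" and "k \<le> n" for x i j k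
    using \<open>k \<le> n\<close>
  proof (induction k)
    case 0
    show ?case using x0 by (simp add: mix_none)
  next
    case (Suc k)
    let ?w = "mix {..<Suc k} x x0"
    have "cmod (G ?w i j - G (?w(k := x0 k)) i j) \<le> sqrt s"
      using Suc.prems x x0 ij by (intro entry_diff_le space_mix space_nth) auto
    then have "cmod (G ?w i j - G (mix {..<k} x x0) i j) \<le> sqrt s"
      using mix_Suc_upd[OF x x0, of k] Suc.prems by simp
    then have "cmod ((G ?w i j - G (mix {..<k} x x0) i j) + (G (mix {..<k} x x0) i j - G x0 i j))
        \<le> sqrt s + real k * sqrt s"
      using Suc by (intro norm_triangle_mono) auto
    then show ?case by (simp add: algebra_simps)
  qed
  define b where "b = (\<Sum>i<d. \<Sum>j<d. cmod (G x0 i j)) + real n * sqrt s"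
  have "cmod (G x i j) \<le> b" if x: "x \<in> space P" and ij: "i < d" "j < d" for x i j
  proof -
    have "cmod (G x0 i j) \<le> (\<Sum>j<d. cmod (G x0 i j))"
      using ij by (intro member_le_sum) auto
    also have "\<dots> \<le> (\<Sum>i<d. \<Sum>j<d. cmod (G x0 i j))"
      using ij by (intro member_le_sum[of i "{..<d}" "\<lambda>i. \<Sum>j<d. cmod (G x0 i j)"] sum_nonneg) auto
    finally have "cmod (G x0 i j) \<le> \<dots>" .
    moreover have "cmod (G x i j - G x0 i j) \<le> real n * sqrt s"
      using *[OF x ij, of n] mix_all[OF x] by simp
    ultimately show ?thesis
      unfolding b_def using norm_triangle_sub[of "G x i j" "G x0 i j"] by simp
  qed
  moreover have "b \<ge> 0" unfolding b_def using s_nonneg by (intro add_nonneg_nonneg sum_nonneg) auto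
  ultimately show ?thesis by blast
qed

definition bnd :: real where
  "bnd = (SOME b. b \<ge> 0 \<and> (\<forall>x\<in>space P. \<forall>i<d. \<forall>j<d. cmod (G x i j) \<le> b))"

lemma bnd_nonneg: "bnd \<ge> 0"
  and G_le_bnd: "x \<in> space P \<Longrightarrow> i < d \<Longrightarrow> j < d \<Longrightarrow> cmod (G x i j) \<le> bnd"
  using someI_ex[OF G_bounded[unfolded Bex_def]] unfolding bnd_def by blast+

section \<open>Martingale differences\<close>

definition EG :: "nat \<Rightarrow> nat \<Rightarrow> complex" where
  "EG i j = (\<integral>x. G x i j \<partial>P)"

definition Y :: "(nat \<Rightarrow> 'b) \<Rightarrow> nat \<Rightarrow> nat \<Rightarrow> complex" where
  "Y x i j = G x i j - EG i j"

text \<open>The conditional expectation given the coordinates below \<open>k\<close>, realised by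
  integrating out a fresh copy of the others. It is defined at every point, so no almost-everywhere
  statements arise.\<close>

definition condG :: "nat \<Rightarrow> (nat \<Rightarrow> 'b) \<Rightarrow> nat \<Rightarrow> nat \<Rightarrow> complex" where
  "condG k x i j = (\<integral>y. G (mix {..<k} x y) i j \<partial>P)"

definition Dif :: "nat \<Rightarrow> (nat \<Rightarrow> 'b) \<Rightarrow> nat \<Rightarrow> nat \<Rightarrow> complex" where
  "Dif k x i j = condG (Suc k) x i j - condG k x i j"

lemma EG_le_bnd: "i < d \<Longrightarrow> j < d \<Longrightarrow> cmod (EG i j) \<le> bnd"
  unfolding EG_def by (intro prod.norm_expectation_le G_measurable G_le_bnd)

lemma Y_measurable: "i < d \<Longrightarrow> j < d \<Longrightarrow> (\<lambda>x. Y x i j) \<in> borel_measurable P"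
  unfolding Y_def by (intro borel_measurable_diff G_measurable borel_measurable_const)

lemma Y_le: "x \<in> space P \<Longrightarrow> i < d \<Longrightarrow> j < d \<Longrightarrow> cmod (Y x i j) \<le> 2 * bnd"
  unfolding Y_def using norm_triangle_ineq4[of "G x i j" "EG i j"] G_le_bnd[of x i j] EG_le_bnd[of i j]
  by simp

lemma Gmix_measurable:
  "x \<in> space P \<Longrightarrow> i < d \<Longrightarrow> j < d \<Longrightarrow> (\<lambda>y. G (mix J x y) i j) \<in> borel_measurable P"
  by (rule measurable_compose[OF measurable_mix_Pair[OF measurable_const measurable_ident_sets[OF refl]] G_measurable])
    auto

lemma Gmix_integrable:
  "x \<in> space P \<Longrightarrow> i < d \<Longrightarrow> j < d \<Longrightarrow> integrable P (\<lambda>y. G (mix J x y) i j)"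
  by (rule prod.integrable_bounded[where b = bnd]) (auto intro!: Gmix_measurable G_le_bnd space_mix)

lemma condG_measurable: "i < d \<Longrightarrow> j < d \<Longrightarrow> (\<lambda>x. condG k x i j) \<in> borel_measurable P"
  unfolding condG_def
proof (rule prod.borel_measurable_lebesgue_integral)
  assume "i < d" "j < d"
  then show "(\<lambda>(x, y). G (mix {..<k} x y) i j) \<in> borel_measurable (P \<Otimes>\<^sub>M P)"
    using measurable_compose[OF measurable_mix G_measurable, of i j "{..<k}"] by (simp add: case_prod_unfold)
qed

lemma condG_le: "x \<in> space P \<Longrightarrow> i < d \<Longrightarrow> j < d \<Longrightarrow> cmod (condG k x i j) \<le> bnd"
  unfolding condG_def by (rule prod.norm_expectation_le) (auto intro!: Gmix_measurable G_le_bnd space_mix)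

lemma Dif_measurable: "i < d \<Longrightarrow> j < d \<Longrightarrow> (\<lambda>x. Dif k x i j) \<in> borel_measurable P"
  unfolding Dif_def by (intro borel_measurable_diff condG_measurable)

lemma Dif_le: "x \<in> space P \<Longrightarrow> i < d \<Longrightarrow> j < d \<Longrightarrow> cmod (Dif k x i j) \<le> 2 * bnd"
  unfolding Dif_def
  using norm_triangle_ineq4[of "condG (Suc k) x i j" "condG k x i j"] condG_le[of x i j k] condG_le[of x i j "Suc k"]
  by simp

text \<open>The sum telescopes from \<open>condG 0\<close>, the mean, to \<open>condG n\<close>, the
  function itself.\<close>

lemma Y_eq_sum_Dif:
  assumes "x \<in> space P" "i < d" "j < d"
  shows "Y x i j = (\<Sum>k<n. Dif k x i j)"
proof -
  have "condG n x i j = G x i j"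
    unfolding condG_def using mix_all[OF assms(1)] by (simp add: measure_space_P)
  moreover have "condG 0 x i j = EG i j"
    unfolding condG_def EG_def by (intro Bochner_Integration.integral_cong refl) (simp add: mix_none)
  ultimately show ?thesis
    unfolding Y_def Dif_def using sum_lessThan_telescope[of "\<lambda>k. condG k x i j" n] by simp
qed

lemma hermitian_integral:
  assumes "\<And>x. x \<in> space P \<Longrightarrow> hermitian_fun d (K x)"
  shows "hermitian_fun d (\<lambda>i j. \<integral>x. K x i j \<partial>P)"
  unfolding hermitian_fun_def
proof (intro allI impI)
  fix i j assume "i < d" "j < d"
  then have "(\<integral>x. K x i j \<partial>P) = (\<integral>x. cnj (K x j i) \<partial>P)"
    using assms unfolding hermitian_fun_def by (intro Bochner_Integration.integral_cong refl) blast
  then show "(\<integral>x. K x i j \<partial>P) = cnj (\<integral>x. K x j i \<partial>P)"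
    by simp
qed

lemma hermitian_fun_diff:
  "hermitian_fun d A \<Longrightarrow> hermitian_fun d B \<Longrightarrow> hermitian_fun d (\<lambda>i j. A i j - B i j)"
  unfolding hermitian_fun_def by (metis complex_cnj_diff)

lemma Y_hermitian: "x \<in> space P \<Longrightarrow> hermitian_fun d (Y x)"
  unfolding Y_def EG_def by (intro hermitian_fun_diff hermitian_integral G_hermitian)

lemma Dif_hermitian: "x \<in> space P \<Longrightarrow> hermitian_fun d (Dif k x)"
  unfolding Dif_def condG_def by (intro hermitian_fun_diff hermitian_integral G_hermitian space_mix)

text \<open>\<open>Dif k x\<close> is the average over \<open>y\<close> of a difference of two
  values of \<open>G\<close> at points that differ in coordinate \<open>k\<close> alone. Jensen's
  inequality in each component carries the pointwise bound over to the average.\<close>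

lemma sqnorm_Dif_le:
  assumes k: "k < n" and x: "x \<in> space P"
  shows "sqnorm d (mapply d (Dif k x) v) \<le> Re (cinner d v (mapply d (S k) v))"
proof -
  define E where "E y = (\<lambda>i j. G (mix {..<Suc k} x y) i j - G (mix {..<k} x y) i j)" for y
  have meas: "(\<lambda>y. mapply d (E y) v i) \<in> borel_measurable P" if "i < d" for i
    unfolding mapply_def E_def using that x
    by (intro borel_measurable_sum borel_measurable_times borel_measurable_diff Gmix_measurable borel_measurable_const) auto
  have E_le: "cmod (mapply d (E y) v i) \<le> (\<Sum>j<d. 2 * bnd * cmod (v j))" if "i < d" "y \<in> space P" for i y
    unfolding mapply_def
  proof (intro order_trans[OF norm_sum] sum_mono)
    fix j assume "j \<in> {..<d}"
    then have "cmod (E y i j) \<le> 2 * bnd"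
      unfolding E_def using that x
        norm_triangle_ineq4[of "G (mix {..<Suc k} x y) i j" "G (mix {..<k} x y) i j"]
        G_le_bnd[OF space_mix[OF x \<open>y \<in> space P\<close>], of i j "{..<Suc k}"]
        G_le_bnd[OF space_mix[OF x \<open>y \<in> space P\<close>], of i j "{..<k}"] by simp
    then show "cmod (E y i j * v j) \<le> 2 * bnd * cmod (v j)"
      by (simp add: norm_mult mult_right_mono)
  qed
  have "mapply d (Dif k x) v i = (\<integral>y. mapply d (E y) v i \<partial>P)" if i: "i < d" for i
  proof -
    have "(\<integral>y. mapply d (E y) v i \<partial>P) = (\<Sum>j<d. \<integral>y. E y i j * v j \<partial>P)"
      unfolding mapply_def using x i unfolding E_def
      by (intro Bochner_Integration.integral_sum integrable_mult_left Bochner_Integration.integrable_diff Gmix_integrable) auto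
    also have "\<dots> = (\<Sum>j<d. Dif k x i j * v j)"
    proof (intro sum.cong refl)
      fix j assume "j \<in> {..<d}"
      then show "(\<integral>y. E y i j * v j \<partial>P) = Dif k x i j * v j"
        unfolding E_def Dif_def condG_def using x i
        by (subst integral_mult_left_zero) (simp add: Bochner_Integration.integral_diff Gmix_integrable)
    qed
    finally show ?thesis unfolding mapply_def by simp
  qed
  then have "sqnorm d (mapply d (Dif k x) v) = (\<Sum>i<d. (cmod (\<integral>y. mapply d (E y) v i \<partial>P))\<^sup>2)"
    unfolding sqnorm_def by (intro sum.cong refl) simp
  also have "\<dots> \<le> (\<Sum>i<d. (\<integral>y. (cmod (mapply d (E y) v i))\<^sup>2 \<partial>P))"
    by (intro sum_mono prod.norm_integral_sq_le[where b = "\<Sum>j<d. 2 * bnd * cmod (v j)"] meas E_le) auto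
  also have "\<dots> = (\<integral>y. sqnorm d (mapply d (E y) v) \<partial>P)"
    unfolding sqnorm_def
  proof (intro Bochner_Integration.integral_sum[symmetric])
    fix i assume "i \<in> {..<d}"
    then show "integrable P (\<lambda>y. (cmod (mapply d (E y) v i))\<^sup>2)"
      using meas[of i] E_le[of i]
      by (intro prod.integrable_bounded[where b = "(\<Sum>j<d. 2 * bnd * cmod (v j))\<^sup>2"])
        (auto intro!: power_mono borel_measurable_power borel_measurable_norm)
  qed
  also have "\<dots> \<le> (\<integral>y. Re (cinner d v (mapply d (S k) v)) \<partial>P)"
  proof (rule integral_mono')
    fix y assume y: "y \<in> space P"
    show "sqnorm d (mapply d (E y) v) \<le> Re (cinner d v (mapply d (S k) v))"
      unfolding E_def mix_Suc_upd[OF x y k]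
      by (intro G_diff k space_mix x y space_nth)
    show "0 \<le> Re (cinner d v (mapply d (S k) v))" by (rule S_nonneg[OF k])
  qed simp
  finally show ?thesis by (simp add: measure_space_P)
qed

text \<open>\<open>condG k\<close> does not see coordinate \<open>k\<close>, and averaging
  \<open>condG (Suc k)\<close> over that coordinate turns it into \<open>condG k\<close>.\<close>

lemma integral_Dif_resample:
  assumes k: "k < n" and x: "x \<in> space P" and ij: "i < d" "j < d"
  shows "(\<integral>z. Dif k (mix {k} z x) i j \<partial>P) = 0"
proof -
  have 1: "condG k (mix {k} z x) i j = condG k x i j" for z
  proof -
    have "mix {..<k} (mix {k} z x) y = mix {..<k} x y" for y
      unfolding mix_def by (intro restrict_ext) auto
    then show ?thesis unfolding condG_def by simp
  qed
  have 2: "condG (Suc k) (mix {k} z x) i j = (\<integral>y. G (mix {..<k} x (mix {k} z y)) i j \<partial>P)" for z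
  proof -
    have "mix {..<Suc k} (mix {k} z x) y = mix {..<k} x (mix {k} z y)" for y
      unfolding mix_def by (intro restrict_ext) auto
    then show ?thesis unfolding condG_def by simp
  qed
  have "(\<integral>z. condG (Suc k) (mix {k} z x) i j \<partial>P) = condG k x i j"
    unfolding 2 unfolding condG_def
    by (rule integral_mix(1)[where b = bnd]) (auto intro!: Gmix_measurable G_le_bnd space_mix x ij)
  moreover have "integrable P (\<lambda>z. condG (Suc k) (mix {k} z x) i j)"
    by (rule prod.integrable_bounded[where b = bnd])
      (auto intro!: condG_le space_mix x ij measurable_const
        measurable_compose[OF measurable_mix_Pair[OF measurable_ident_sets[OF refl] measurable_const] condG_measurable])
  ultimately show ?thesis
    unfolding Dif_def 1 by (simp add: measure_space_P Bochner_Integration.integral_diff)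
qed

lemma integral_Dif_mult_resample:
  assumes k: "k < n" and z: "z \<in> space P" and ij: "i < d" "j < d"
    and f: "f \<in> borel_measurable P" "\<And>x. x \<in> space P \<Longrightarrow> cmod (f x) \<le> c"
  shows "(\<integral>x. Dif k x i j * f (mix {k} z x) \<partial>P) = 0"
proof -
  let ?h = "\<lambda>x. Dif k x i j * f (mix {k} z x)"
  have fm: "(\<lambda>x. f (mix {k} z x)) \<in> borel_measurable P"
    by (rule measurable_compose[OF measurable_mix_Pair[OF measurable_const[OF z] measurable_ident_sets[OF refl]] f(1)])
  have "0 \<le> c" using f(2)[OF z] norm_ge_zero order_trans by blast
  \<comment> \<open>With \<open>z\<close> fixed, the factor with \<open>f\<close> does not depend on
    coordinate \<open>k\<close> of \<open>x\<close>. Renewing this coordinate from \<open>y\<close>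
    therefore averages the martingale difference alone.\<close>
  have "(\<integral>x. ?h x \<partial>P) = (\<integral>x. (\<integral>y. ?h (mix {k} y x) \<partial>P) \<partial>P)"
  proof (rule integral_mix(2)[symmetric, where b = "2 * bnd * c"])
    show "?h \<in> borel_measurable P" by (intro borel_measurable_times Dif_measurable ij fm)
    fix x assume "x \<in> space P"
    then show "cmod (?h x) \<le> 2 * bnd * c"
      unfolding norm_mult using \<open>0 \<le> c\<close> bnd_nonneg
      by (intro mult_mono Dif_le ij f space_mix z) auto
  qed
  also have "\<dots> = (\<integral>x. 0 \<partial>P)"
  proof (intro Bochner_Integration.integral_cong refl)
    fix x assume x: "x \<in> space P"
    have "mix {k} z (mix {k} y x) = mix {k} z x" for y
      unfolding mix_def by (intro restrict_ext) auto
    then show "(\<integral>y. ?h (mix {k} y x) \<partial>P) = 0"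
      using integral_Dif_resample[OF k x ij] by simp
  qed
  finally show ?thesis by simp
qed

section \<open>The trace moment generating function\<close>

abbreviation expY :: "real \<Rightarrow> (nat \<Rightarrow> 'b) \<Rightarrow> nat \<Rightarrow> nat \<Rightarrow> complex" where
  "expY t x \<equiv> mexp d t (Y x)"

definition trexp :: "real \<Rightarrow> (nat \<Rightarrow> 'b) \<Rightarrow> real" where
  "trexp t x = Re (\<Sum>i<d. expY t x i i)"

definition mgf :: "real \<Rightarrow> real" where
  "mgf t = (\<integral>x. trexp t x \<partial>P)"

lemma expY_measurable: "i < d \<Longrightarrow> j < d \<Longrightarrow> (\<lambda>x. expY t x i j) \<in> borel_measurable P"
  by (intro borel_measurable_mexp Y_measurable)

lemma expY_le: "x \<in> space P \<Longrightarrow> i < d \<Longrightarrow> j < d \<Longrightarrow> cmod (expY t x i j) \<le> exp (\<bar>t\<bar> * (real d * (2 * bnd)))"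
  using bnd_nonneg by (intro norm_mexp_le Y_le) auto

text \<open>\<open>g\<close> will be the identity or the resampling of one coordinate from a fixed
  point.\<close>

lemma integrable_mtrprod_expY:
  assumes A: "\<And>i j. i < d \<Longrightarrow> j < d \<Longrightarrow> (\<lambda>x. A x i j) \<in> borel_measurable P"
      "\<And>x i j. x \<in> space P \<Longrightarrow> i < d \<Longrightarrow> j < d \<Longrightarrow> cmod (A x i j) \<le> a" "a \<ge> 0"
    and g: "g \<in> measurable P P"
  shows "integrable P (\<lambda>x. mtrprod d (A x) (expY t (g x)))"
proof (rule prod.integrable_bounded)
  show "(\<lambda>x. mtrprod d (A x) (expY t (g x))) \<in> borel_measurable P"
    by (intro borel_measurable_mtrprod A measurable_compose[OF g expY_measurable])
  show "cmod (mtrprod d (A x) (expY t (g x))) \<le> real d * (real d * (a * exp (\<bar>t\<bar> * (real d * (2 * bnd)))))"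
    if "x \<in> space P" for x
    using that by (intro norm_mtrprod_le A expY_le measurable_space[OF g])
qed

lemma measurable_resample: "z \<in> space P \<Longrightarrow> mix {k} z \<in> measurable P P"
  using measurable_mix_Pair[OF measurable_const measurable_ident_sets[OF refl]] by simp

lemma S_entry_le: "\<exists>a\<ge>0. \<forall>i<d. \<forall>j<d. cmod (S k i j) \<le> a"
proof (intro exI conjI allI impI)
  show "0 \<le> (\<Sum>i<d. \<Sum>j<d. cmod (S k i j))" by (intro sum_nonneg) auto
  fix i j assume "i < d" "j < d"
  have "cmod (S k i j) \<le> (\<Sum>j<d. cmod (S k i j))"
    using \<open>j < d\<close> by (intro member_le_sum) auto
  also have "\<dots> \<le> (\<Sum>i<d. \<Sum>j<d. cmod (S k i j))"
    using \<open>i < d\<close> by (intro member_le_sum[of i "{..<d}" "\<lambda>i. \<Sum>j<d. cmod (S k i j)"] sum_nonneg) auto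
  finally show "cmod (S k i j) \<le> \<dots>" .
qed

lemma integrable_S_expY:
  assumes g: "g \<in> measurable P P"
  shows "integrable P (\<lambda>x. mtrprod d (S k) (expY t (g x)))"
proof -
  obtain a where "a \<ge> 0" "\<And>i j. i < d \<Longrightarrow> j < d \<Longrightarrow> cmod (S k i j) \<le> a"
    using S_entry_le[of k] by blast
  then show ?thesis by (intro integrable_mtrprod_expY[where a = a] g) auto
qed

lemma integrable_Dif_expY:
  assumes g: "g \<in> measurable P P"
  shows "integrable P (\<lambda>x. mtrprod d (Dif k x) (expY t (g x)))"
  using bnd_nonneg by (intro integrable_mtrprod_expY[where a = "2 * bnd"] Dif_measurable Dif_le g) auto

lemma integral_Dif_expY_resample:
  assumes k: "k < n" and z: "z \<in> space P"
  shows "(\<integral>x. mtrprod d (Dif k x) (expY t (mix {k} z x)) \<partial>P) = 0"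
proof -
  let ?h = "\<lambda>i j x. Dif k x i j * expY t (mix {k} z x) j i"
  let ?b = "exp (\<bar>t\<bar> * (real d * (2 * bnd)))"
  have int: "integrable P (?h i j)" if "i < d" "j < d" for i j
  proof (rule prod.integrable_bounded)
    show "?h i j \<in> borel_measurable P"
      using that by (intro borel_measurable_times Dif_measurable
          measurable_compose[OF measurable_resample[OF z] expY_measurable])
    show "cmod (?h i j x) \<le> 2 * bnd * ?b" if "x \<in> space P" for x
      using that \<open>i < d\<close> \<open>j < d\<close> bnd_nonneg unfolding norm_mult
      by (intro mult_mono Dif_le expY_le space_mix z) auto
  qed
  have "(\<integral>x. mtrprod d (Dif k x) (expY t (mix {k} z x)) \<partial>P) = (\<Sum>i<d. \<integral>x. (\<Sum>j<d. ?h i j x) \<partial>P)"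
    unfolding mtrprod_def
    by (rule Bochner_Integration.integral_sum) (auto intro!: Bochner_Integration.integrable_sum int)
  also have "\<dots> = (\<Sum>i<d. \<Sum>j<d. \<integral>x. ?h i j x \<partial>P)"
    by (intro sum.cong refl Bochner_Integration.integral_sum int) auto
  also have "\<dots> = 0"
    by (intro sum.neutral ballI integral_Dif_mult_resample[where c = ?b] k z)
      (auto intro!: expY_measurable expY_le)
  finally show ?thesis .
qed

text \<open>Resampling the \<open>k\<close>-th coordinate of the exponent alone makes the martingale difference
  average out, so only the difference of the two exponentials contributes.\<close>

lemma integral_Dif_expY_le:
  assumes k: "k < n" and t: "t \<ge> 0"
  shows "(\<integral>x. Re (mtrprod d (Dif k x) (expY t x)) \<partial>P) \<le> 2 * t * (\<integral>x. Re (mtrprod d (S k) (expY t x)) \<partial>P)"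
proof -
  define q where "q x = Re (mtrprod d (Dif k x) (expY t x))" for x
  define p where "p x = Re (mtrprod d (S k) (expY t x))" for x
  have id: "(\<lambda>x. x) \<in> measurable P P" by (rule measurable_ident_sets) simp
  have q: "integrable P q" unfolding q_def using integrable_Dif_expY[OF id] by (rule integrable_Re)
  have p: "integrable P (\<lambda>x. p (g x))" if "g \<in> measurable P P" for g
    unfolding p_def using integrable_S_expY[OF that] by (rule integrable_Re)
  \<comment> \<open>The resampling point \<open>z\<close> is frozen. Then \<open>r\<close> has mean
    zero, so it can be subtracted from \<open>q\<close> before the mean value inequality is applied
    at each \<open>x\<close>.\<close>
  have fixed: "(\<integral>x. q x \<partial>P) \<le> t * ((\<integral>x. p x \<partial>P) + (\<integral>x. p (mix {k} z x) \<partial>P))" if z: "z \<in> space P" for z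
  proof -
    note m = measurable_resample[OF z, of k]
    define r where "r x = Re (mtrprod d (Dif k x) (expY t (mix {k} z x)))" for x
    have r: "integrable P r" unfolding r_def using integrable_Dif_expY[OF m] by (rule integrable_Re)
    have "(\<integral>x. r x \<partial>P) = 0"
      unfolding r_def integral_Re[OF integrable_Dif_expY[OF m]]
      using integral_Dif_expY_resample[OF k z] by simp
    then have "(\<integral>x. q x \<partial>P) = (\<integral>x. q x - r x \<partial>P)"
      using q r by simp
    also have "\<dots> \<le> (\<integral>x. t * (p x + p (mix {k} z x)) \<partial>P)"
    proof (intro integral_mono integrable_mult_right Bochner_Integration.integrable_add
        Bochner_Integration.integrable_diff q r p[OF id] p[OF m])
      fix x assume x: "x \<in> space P"
      have x': "mix {k} z x \<in> space P" by (intro space_mix z x)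
      have "sqnorm d (mapply d (\<lambda>i j. Y x i j - Y (mix {k} z x) i j) v) \<le> Re (cinner d v (mapply d (S k) v))"
        for v
        using G_diff[OF k x space_nth[OF z k], of v] unfolding Y_def mix_single_eq_upd[OF x k] by simp
      then show "q x - r x \<le> t * (p x + p (mix {k} z x))"
        unfolding q_def r_def p_def
        by (intro exp_mean_value_trace Y_hermitian Dif_hermitian sqnorm_Dif_le k x x' t)
    qed
    also have "\<dots> = t * ((\<integral>x. p x \<partial>P) + (\<integral>x. p (mix {k} z x) \<partial>P))"
      using p[OF id] p[OF m] by simp
    finally show ?thesis .
  qed
  obtain a where a: "a \<ge> 0" "\<And>i j. i < d \<Longrightarrow> j < d \<Longrightarrow> cmod (S k i j) \<le> a"
    using S_entry_le[of k] by blast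
  define b where "b = real d * (real d * (a * exp (\<bar>t\<bar> * (real d * (2 * bnd)))))"
  have p_le: "norm (p x) \<le> b" if "x \<in> space P" for x
    unfolding p_def b_def real_norm_def using that
    by (intro order_trans[OF abs_Re_le_cmod] norm_mtrprod_le a expY_le)
  have p_meas: "p \<in> borel_measurable P" using p[OF id] by simp
  have mix_meas: "case_prod (\<lambda>z x. p (mix {k} z x)) \<in> borel_measurable (P \<Otimes>\<^sub>M P)"
    using measurable_compose[OF measurable_mix p_meas] by (simp add: case_prod_unfold)
  \<comment> \<open>The left side does not depend on \<open>z\<close>. Averaging over
    \<open>z\<close> gives \<open>mix {k} z x\<close> the law of \<open>x\<close>, so the two terms
    on the right coincide and produce the factor 2.\<close>
  have "(\<integral>x. q x \<partial>P) = (\<integral>z. (\<integral>x. q x \<partial>P) \<partial>P)" by (simp add: measure_space_P)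
  also have int: "integrable P (\<lambda>z. \<integral>x. p (mix {k} z x) \<partial>P)"
    using prod.borel_measurable_lebesgue_integral[OF mix_meas]
  proof (rule prod.integrable_bounded[where b = b])
    fix z assume z: "z \<in> space P"
    show "norm (\<integral>x. p (mix {k} z x) \<partial>P) \<le> b"
      using p[OF measurable_resample[OF z]] z by (intro prod.norm_expectation_le p_le space_mix) auto
  qed
  then have "(\<integral>z. (\<integral>x. q x \<partial>P) \<partial>P) \<le> (\<integral>z. t * ((\<integral>x. p x \<partial>P) + (\<integral>x. p (mix {k} z x) \<partial>P)) \<partial>P)"
    by (intro integral_mono integrable_mult_right Bochner_Integration.integrable_add fixed) auto
  also have "\<dots> = t * ((\<integral>x. p x \<partial>P) + (\<integral>z. (\<integral>x. p (mix {k} z x) \<partial>P) \<partial>P))"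
    using int by (simp add: measure_space_P)
  also have "(\<integral>z. (\<integral>x. p (mix {k} z x) \<partial>P) \<partial>P) = (\<integral>x. p x \<partial>P)"
    by (rule integral_mix(1)[OF p_meas p_le])
  finally show ?thesis unfolding p_def q_def by simp
qed

lemma trexp_measurable: "trexp t \<in> borel_measurable P"
  unfolding trexp_def by (intro borel_measurable_Re[THEN measurable_compose[rotated]] borel_measurable_sum expY_measurable) auto

lemma trexp_eigenbasis: "eigenbasis d (Y x) lam u \<Longrightarrow> trexp t x = (\<Sum>k<d. exp (t * lam k))"
  unfolding trexp_def by (simp add: trace_mexp)

lemma trexp_nonneg: "x \<in> space P \<Longrightarrow> 0 \<le> trexp t x"
  using hermitian_eigenbasis_exists[OF Y_hermitian, of x] trexp_eigenbasis[of x]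
  by (metis exp_ge_zero sum_nonneg)

lemma integrable_trexp: "integrable P (trexp t)"
proof (rule prod.integrable_bounded[OF trexp_measurable])
  fix x assume "x \<in> space P"
  then show "norm (trexp t x) \<le> (\<Sum>i<d. exp (\<bar>t\<bar> * (real d * (2 * bnd))))"
    unfolding trexp_def real_norm_def
    by (intro order_trans[OF abs_Re_le_cmod] order_trans[OF norm_sum] sum_mono expY_le) auto
qed

lemma mgf_nonneg: "0 \<le> mgf t"
  unfolding mgf_def by (intro integral_nonneg_AE AE_I2 trexp_nonneg)

lemma mgf_0: "mgf 0 = real d"
proof -
  have "trexp 0 x = real d" if "x \<in> space P" for x
    using hermitian_eigenbasis_exists[OF Y_hermitian[OF that]] trexp_eigenbasis[of x _ _ 0] by auto
  then have "mgf 0 = (\<integral>x. real d \<partial>P)"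
    unfolding mgf_def by (intro Bochner_Integration.integral_cong refl)
  then show ?thesis by (simp add: measure_space_P)
qed

text \<open>In an eigenbasis of \<open>Y x\<close> the trace is a positive combination of the
  quadratic form of the sum of all \<open>S k\<close> on unit vectors, and there the form is at most
  \<open>s\<close>.\<close>

lemma sum_S_expY_le:
  assumes "x \<in> space P"
  shows "(\<Sum>k<n. Re (mtrprod d (S k) (expY t x))) \<le> s * trexp t x"
proof -
  obtain lam u where eb: "eigenbasis d (Y x) lam u"
    using hermitian_eigenbasis_exists[OF Y_hermitian[OF assms]] by blast
  have "(\<Sum>k<n. Re (mtrprod d (S k) (expY t x)))
      = (\<Sum>j<d. exp (t * lam j) * (\<Sum>k<n. Re (cinner d (u j) (mapply d (S k) (u j)))))"
    unfolding mtrprod_mexp[OF eb] by (simp add: sum_distrib_left) (rule sum.swap)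
  also have "\<dots> \<le> (\<Sum>j<d. exp (t * lam j) * (s * 1))"
  proof (intro sum_mono mult_left_mono)
    fix j assume "j \<in> {..<d}"
    then show "(\<Sum>k<n. Re (cinner d (u j) (mapply d (S k) (u j)))) \<le> s * 1"
      using S_sum[of "u j"] sqnorm_eigenbasis[OF eb, of j] by simp
  qed auto
  finally show ?thesis unfolding trexp_eigenbasis[OF eb] by (simp add: sum_distrib_left mult.commute)
qed

text \<open>The left side is the formal derivative of \<open>mgf\<close> at \<open>t\<close>. The
  martingale decomposition is applied to the factor \<open>Y x\<close> and not inside the
  exponential.\<close>

lemma integral_Y_expY_le:
  assumes t: "t \<ge> 0"
  shows "(\<integral>x. Re (mtrprod d (Y x) (expY t x)) \<partial>P) \<le> 2 * t * s * mgf t"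
proof -
  have id: "(\<lambda>x. x) \<in> measurable P P" by (rule measurable_ident_sets) simp
  have D: "integrable P (\<lambda>x. Re (mtrprod d (Dif k x) (expY t x)))" for k
    using integrable_Dif_expY[OF id] by (rule integrable_Re)
  have S: "integrable P (\<lambda>x. Re (mtrprod d (S k) (expY t x)))" for k
    using integrable_S_expY[OF id] by (rule integrable_Re)
  have "(\<integral>x. Re (mtrprod d (Y x) (expY t x)) \<partial>P) = (\<integral>x. (\<Sum>k<n. Re (mtrprod d (Dif k x) (expY t x))) \<partial>P)"
  proof (intro Bochner_Integration.integral_cong refl)
    fix x assume x: "x \<in> space P"
    have "mtrprod d (Y x) (expY t x) = mtrprod d (\<lambda>i j. \<Sum>k<n. Dif k x i j) (expY t x)"
      by (intro mtrprod_cong Y_eq_sum_Dif x refl)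
    then show "Re (mtrprod d (Y x) (expY t x)) = (\<Sum>k<n. Re (mtrprod d (Dif k x) (expY t x)))"
      by (simp add: mtrprod_sum_left)
  qed
  also have "\<dots> = (\<Sum>k<n. \<integral>x. Re (mtrprod d (Dif k x) (expY t x)) \<partial>P)"
    by (intro Bochner_Integration.integral_sum D)
  also have "\<dots> \<le> (\<Sum>k<n. 2 * t * (\<integral>x. Re (mtrprod d (S k) (expY t x)) \<partial>P))"
    by (intro sum_mono integral_Dif_expY_le t) auto
  also have "\<dots> = 2 * t * (\<integral>x. (\<Sum>k<n. Re (mtrprod d (S k) (expY t x))) \<partial>P)"
    unfolding sum_distrib_left[symmetric]
    by (subst Bochner_Integration.integral_sum) (auto intro: S)
  also have "\<dots> \<le> 2 * t * (\<integral>x. s * trexp t x \<partial>P)"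
    using t by (intro mult_left_mono integral_mono sum_S_expY_le Bochner_Integration.integrable_sum S
        integrable_mult_right integrable_trexp) auto
  finally show ?thesis unfolding mgf_def by simp
qed

text \<open>A finite-difference form of \<open>mgf' t \<le> 2 * t * s * mgf t\<close>. Convexity of
  the exponential bounds the increment by the slope at the right endpoint, which is why
  \<open>mgf t\<close> appears with a factor on the left.\<close>

lemma mgf_step:
  assumes "0 \<le> r" "r \<le> t"
  shows "mgf t * (1 - 2 * s * t * (t - r)) \<le> mgf r"
proof -
  have id: "(\<lambda>x. x) \<in> measurable P P" by (rule measurable_ident_sets) simp
  have W: "integrable P (\<lambda>x. Re (mtrprod d (Y x) (expY t x)))"
    using bnd_nonneg
    by (intro integrable_Re integrable_mtrprod_expY[where a = "2 * bnd", OF _ _ _ id] Y_measurable Y_le) auto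
  have "mgf t - mgf r = (\<integral>x. trexp t x - trexp r x \<partial>P)"
    unfolding mgf_def by (simp add: integrable_trexp)
  also have "\<dots> \<le> (\<integral>x. (t - r) * Re (mtrprod d (Y x) (expY t x)) \<partial>P)"
  proof (intro integral_mono Bochner_Integration.integrable_diff integrable_trexp integrable_mult_right W)
    fix x assume x: "x \<in> space P"
    obtain lam u where eb: "eigenbasis d (Y x) lam u"
      using hermitian_eigenbasis_exists[OF Y_hermitian[OF x]] by blast
    have "exp (t * a) - exp (r * a) \<le> (t - r) * (a * exp (t * a))" for a
    proof -
      have "exp (t * a) * (1 + (r * a - t * a)) \<le> exp (t * a) * exp (r * a - t * a)"
        by (intro mult_left_mono exp_ge_add_one_self) auto
      also have "\<dots> = exp (r * a)" by (simp flip: exp_add)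
      finally show ?thesis by (simp add: algebra_simps)
    qed
    then have "(\<Sum>k<d. exp (t * lam k) - exp (r * lam k)) \<le> (\<Sum>k<d. (t - r) * (lam k * exp (t * lam k)))"
      by (intro sum_mono)
    then show "trexp t x - trexp r x \<le> (t - r) * Re (mtrprod d (Y x) (expY t x))"
      unfolding trexp_eigenbasis[OF eb] mtrprod_self_mexp[OF eb]
      by (simp add: sum_subtractf sum_distrib_left)
  qed
  also have "\<dots> = (t - r) * (\<integral>x. Re (mtrprod d (Y x) (expY t x)) \<partial>P)" by simp
  also have "\<dots> \<le> (t - r) * (2 * t * s * mgf t)"
    using assms by (intro mult_left_mono integral_Y_expY_le) auto
  finally show ?thesis by (simp add: algebra_simps)
qed

text \<open>Cutting \<open>[0, t]\<close> into \<open>K\<close> equal steps and multiplying the step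
  inequalities gives a power that tends to \<open>exp x\<close>.\<close>

lemma mgf_le:
  assumes t: "t \<ge> 0"
  shows "mgf t \<le> real d * exp (2 * s * t\<^sup>2)"
proof -
  define x where "x = - (2 * s * t\<^sup>2)"
  \<comment> \<open>The lower bound on \<open>K\<close> keeps the factor
    \<open>1 + x / real K\<close> nonnegative, as multiplying the inequalities requires.\<close>
  have fin: "mgf t * (1 + x / real K) ^ K \<le> real d" if K: "K > 0" "- x \<le> real K" for K :: nat
  proof -
    define h where "h = t / real K"
    have h: "h \<ge> 0" using t by (simp add: h_def)
    have c: "1 - 2 * s * t * h = 1 + x / real K" by (simp add: x_def h_def power2_eq_square)
    have c0: "0 \<le> 1 + x / real K" using K by (simp add: field_simps)
    have "mgf (real j * h) * (1 + x / real K) ^ j \<le> real d" if "j \<le> K" for j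
      using that
    proof (induction j)
      case 0
      show ?case by (simp add: mgf_0)
    next
      case (Suc j)
      have "real (Suc j) * h \<le> real K * h" using Suc.prems h by (intro mult_right_mono) auto
      then have le: "real (Suc j) * h \<le> t" using K by (simp add: h_def)
      \<comment> \<open>The slope at each grid point is replaced by the largest one, at
        \<open>t\<close>. This makes all factors equal and is where \<open>s * t^2\<close> is
        weakened to \<open>2 * s * t^2\<close>.\<close>
      have "2 * s * (real (Suc j) * h) * h \<le> 2 * s * t * h"
        using le h s_nonneg by (intro mult_right_mono mult_left_mono) auto
      then have "mgf (real (Suc j) * h) * (1 + x / real K)
          \<le> mgf (real (Suc j) * h) * (1 - 2 * s * (real (Suc j) * h) * (real (Suc j) * h - real j * h))"
        unfolding c[symmetric] by (intro mult_left_mono mgf_nonneg) (simp add: algebra_simps)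
      also have "\<dots> \<le> mgf (real j * h)"
        using h by (intro mgf_step mult_right_mono) auto
      finally have "mgf (real (Suc j) * h) * (1 + x / real K) * (1 + x / real K) ^ j
          \<le> mgf (real j * h) * (1 + x / real K) ^ j"
        using c0 by (intro mult_right_mono) auto
      then show ?case using Suc by (simp add: mult.assoc)
    qed
    from this[of K] show ?thesis using K by (simp add: h_def)
  qed
  have "(\<lambda>K. mgf t * (1 + x / real K) ^ K) \<longlonglongrightarrow> mgf t * exp x"
    by (intro tendsto_mult tendsto_const tendsto_exp_limit_sequentially)
  moreover have "\<exists>K0. \<forall>K\<ge>K0. mgf t * (1 + x / real K) ^ K \<le> real d"
  proof (intro exI allI impI)
    fix K :: nat assume "K \<ge> nat \<lceil>- x\<rceil> + 1"
    then show "mgf t * (1 + x / real K) ^ K \<le> real d" by (intro fin) linarith+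
  qed
  ultimately have "mgf t * exp x \<le> real d" by (rule LIMSEQ_le_const2)
  then show ?thesis unfolding x_def by (simp add: exp_minus field_simps)
qed

text \<open>Markov's inequality; the chosen \<open>t\<close> minimises
  \<open>2 * s * t^2 - t * \<theta>\<close>.\<close>

lemma trexp_tail:
  assumes "s > 0" "\<theta> \<ge> 0"
  defines "t \<equiv> \<theta> / (4 * s)"
  shows "measure P {x \<in> space P. exp (t * \<theta>) \<le> trexp t x} \<le> real d * exp (- \<theta>\<^sup>2 / (8 * s))"
proof -
  have t: "t \<ge> 0" using assms by simp
  have "measure P {x \<in> space P. exp (t * \<theta>) \<le> trexp t x} \<le> mgf t / exp (t * \<theta>)"
    unfolding mgf_def
    by (rule integral_Markov_inequality_measure[OF integrable_trexp sets.top]) (auto intro: trexp_nonneg)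
  also have "\<dots> \<le> real d * exp (2 * s * t\<^sup>2) / exp (t * \<theta>)"
    by (intro divide_right_mono mgf_le t) auto
  also have "\<dots> = real d * exp (2 * s * t\<^sup>2 - t * \<theta>)" by (simp add: exp_diff)
  also have "2 * s * t\<^sup>2 - t * \<theta> = - \<theta>\<^sup>2 / (8 * s)"
    unfolding t_def using assms by (simp add: field_simps power2_eq_square)
  finally show ?thesis .
qed

text \<open>All terms of the trace exponential are positive, so it dominates the term of any single
  eigenvalue.\<close>

lemma trexp_ge_eigenvalue:
  assumes x: "x \<in> space P" and ev: "\<And>i. i < d \<Longrightarrow> mapply d (Y x) v i = c * v i" and v: "\<exists>i<d. v i \<noteq> 0"
    and c: "\<theta> \<le> Re c" and t: "t \<ge> 0"
  shows "exp (t * \<theta>) \<le> trexp t x"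
proof -
  obtain lam u where eb: "eigenbasis d (Y x) lam u"
    using hermitian_eigenbasis_exists[OF Y_hermitian[OF x]] by blast
  obtain k where k: "k < d" "c = of_real (lam k)"
    using eigenvalue_in_eigenbasis[OF eb Y_hermitian[OF x] ev v] by blast
  have "exp (t * \<theta>) \<le> exp (t * lam k)" using c k t by (simp add: mult_left_mono)
  also have "\<dots> \<le> (\<Sum>k<d. exp (t * lam k))" using k by (intro member_le_sum) auto
  finally show ?thesis unfolding trexp_eigenbasis[OF eb] .
qed

end

section \<open>Block circulant matrices\<close>

abbreviation (input) entries :: "complex mat \<Rightarrow> nat \<Rightarrow> nat \<Rightarrow> complex" where
  "entries M \<equiv> \<lambda>i j. M $$ (i, j)"

lemma bcirc_carrier [simp]: "bcirc m n p A \<in> carrier_mat (m * p) (n * p)"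
  by (simp add: bcirc_def)

lemma bcirc_entry:
  "i < m * p \<Longrightarrow> j < n * p \<Longrightarrow>
    bcirc m n p A $$ (i, j) = A ((i div m + p - j div n) mod p) $$ (i mod m, j mod n)"
  by (simp add: bcirc_def)

lemma block_index_bounds:
  fixes i m p :: nat
  assumes "i < m * p"
  shows "i div m < p" "i mod m < m" "0 < m" "0 < p"
  using assms by (auto simp: less_mult_imp_div_less mult.commute intro!: mod_less_divisor gr0I)

lemma mat_adjoint_entry:
  "B \<in> carrier_mat r c \<Longrightarrow> i < c \<Longrightarrow> j < r \<Longrightarrow> mat_adjoint B $$ (i, j) = cnj (B $$ (j, i))"
  unfolding mat_adjoint_def by (simp add: mat_of_rows_index)

lemma mod_diff_cases:
  fixes a b p :: nat
  assumes "a < p" "b < p"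
  shows "(a + p - b) mod p = (if b \<le> a then a - b else a + p - b)"
proof (cases "b \<le> a")
  case True
  then have "(a + p - b) mod p = (a - b + p) mod p" by simp
  also have "\<dots> = (a - b) mod p" by (rule mod_add_self2)
  finally show ?thesis using True assms by simp
qed (use assms in simp)

text \<open>Exchanging the two block indices sends the slice index \<open>k\<close> to
  \<open>(p - k) mod p\<close>, exactly the reversal in the conjugate transpose.\<close>

lemma hermitian_bcirc:
  assumes "hermitian_tensor m p A"
  shows "hermitian_fun (m * p) (entries (bcirc m m p A))"
  unfolding hermitian_fun_def
proof (intro allI impI)
  fix i j assume ij: "i < m * p" "j < m * p"
  note b = block_index_bounds[OF ij(1)] block_index_bounds[OF ij(2)]
  define k where "k = (i div m + p - j div m) mod p"
  have k: "k < p" using b by (simp add: k_def)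
  have l: "(p - k) mod p = (j div m + p - i div m) mod p"
    using b mod_diff_cases[of "i div m" p "j div m"] mod_diff_cases[of "j div m" p "i div m"]
    unfolding k_def by (auto split: if_splits)
  have "A k = mat_adjoint (A ((p - k) mod p))"
    using assms k unfolding hermitian_tensor_def tconj_def by simp
  moreover have "A ((p - k) mod p) \<in> carrier_mat m m"
    using assms k unfolding hermitian_tensor_def is_tensor_def by simp
  ultimately have "A k $$ (i mod m, j mod m) = cnj (A ((p - k) mod p) $$ (j mod m, i mod m))"
    using mat_adjoint_entry b by metis
  then show "bcirc m m p A $$ (i, j) = cnj (bcirc m m p A $$ (j, i))"
    unfolding bcirc_entry[OF ij] bcirc_entry[OF ij(2,1)] k_def[symmetric] l .
qed

lemma bcirc_tsq_entry:
  assumes ij: "i < m * p" "j < m * p"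
  shows "bcirc m m p (tsq m p A) $$ (i, j) = (\<Sum>l<m * p. bcirc m m p A $$ (i, l) * bcirc m m p A $$ (l, j))"
proof -
  note b = block_index_bounds[OF ij(1)] block_index_bounds[OF ij(2)]
  define a where "a = i div m"
  define c where "c = j div m"
  have ac: "a < p" "c < p" using b by (auto simp: a_def c_def)
  define k where "k = (a + p - c) mod p"
  have "bcirc m m p (tsq m p A) $$ (i, j)
      = (\<Sum>(r, q)\<in>{..<p} \<times> {..<m}. A ((k + p - r) mod p) $$ (i mod m, q) * A r $$ (q, j mod m))"
    unfolding bcirc_entry[OF ij] tsq_def tprod_def using b
    by (simp add: k_def a_def c_def sum.cartesian_product)
  also have "\<dots> = (\<Sum>l<m * p. bcirc m m p A $$ (i, l) * bcirc m m p A $$ (l, j))"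
  \<comment> \<open>A middle index \<open>l\<close> corresponds to slice \<open>r\<close> and offset
    \<open>q\<close> with \<open>l div m = (r + c) mod p\<close>. Then block
    \<open>(l div m, c)\<close> is slice \<open>r\<close>, and block \<open>(a, l div m)\<close> is
    slice \<open>(k - r) mod p\<close>.\<close>
  proof (rule sum.reindex_bij_witness
      [of _ "\<lambda>l. ((l div m + p - c) mod p, l mod m)" "\<lambda>(r, q). ((r + c) mod p) * m + q"])
    fix rq assume rq: "rq \<in> {..<p} \<times> {..<m}"
    obtain r q where [simp]: "rq = (r, q)" and r: "r < p" and q: "q < m" using rq by auto
    define e where "e = (r + c) mod p"
    have e: "e < p" "e = (if r + c < p then r + c else r + c - p)"
      using r ac unfolding e_def by (auto simp: le_mod_geq)
    have r': "(e + p - c) mod p = r"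
      using mod_diff_cases[OF e(1) ac(2)] e r ac by (auto split: if_splits)
    then show "(case case rq of (r, q) \<Rightarrow> ((r + c) mod p) * m + q of l \<Rightarrow> ((l div m + p - c) mod p, l mod m)) = rq"
      using q by (simp add: e_def)
    have l: "e * m + q < m * p"
    proof -
      have "e * m + q < (e + 1) * m" using q by simp
      also have "\<dots> \<le> p * m" using e(1) by (intro mult_right_mono) auto
      finally show ?thesis by (simp add: mult.commute)
    qed
    then show "(case rq of (r, q) \<Rightarrow> ((r + c) mod p) * m + q) \<in> {..<m * p}"
      by (simp add: e_def)
    have k: "k = (if c \<le> a then a - c else a + p - c)"
      unfolding k_def by (rule mod_diff_cases[OF ac])
    then have kp: "k < p" using ac by (auto split: if_splits)
    have "(k + p - r) mod p = (a + p - e) mod p"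
      unfolding mod_diff_cases[OF kp r] mod_diff_cases[OF ac(1) e(1)]
      using k e(2) r ac by (auto split: if_splits)
    then show "bcirc m m p A $$ (i, case rq of (r, q) \<Rightarrow> ((r + c) mod p) * m + q)
        * bcirc m m p A $$ (case rq of (r, q) \<Rightarrow> ((r + c) mod p) * m + q, j)
      = (case rq of (r, q) \<Rightarrow> A ((k + p - r) mod p) $$ (i mod m, q) * A r $$ (q, j mod m))"
      using l q ij r' by (simp add: bcirc_entry e_def a_def c_def)
  next
    fix l assume "l \<in> {..<m * p}"
    then have l: "l < m * p" by simp
    note bl = block_index_bounds[OF l]
    have "((l div m + p - c) mod p + c) mod p = l div m"
      using mod_diff_cases[OF bl(1) ac(2)] bl ac by (auto simp: le_mod_geq)
    then show "(case ((l div m + p - c) mod p, l mod m) of (r, q) \<Rightarrow> ((r + c) mod p) * m + q) = l"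
      by simp
    show "((l div m + p - c) mod p, l mod m) \<in> {..<p} \<times> {..<m}"
      using bl by simp
  qed
  finally show ?thesis .
qed

lemma hermitian_bcirc_tsq:
  assumes "hermitian_fun (m * p) (entries (bcirc m m p A))"
  shows "hermitian_fun (m * p) (entries (bcirc m m p (tsq m p A)))"
  unfolding hermitian_fun_def
proof (intro allI impI)
  fix i j assume ij: "i < m * p" "j < m * p"
  have "bcirc m m p A $$ (i, l) * bcirc m m p A $$ (l, j)
      = cnj (bcirc m m p A $$ (j, l) * bcirc m m p A $$ (l, i))" if "l < m * p" for l
    using assms ij that unfolding hermitian_fun_def complex_cnj_mult by (metis mult.commute)
  then show "bcirc m m p (tsq m p A) $$ (i, j) = cnj (bcirc m m p (tsq m p A) $$ (j, i))"
    unfolding bcirc_tsq_entry[OF ij] bcirc_tsq_entry[OF ij(2,1)] cnj_sum by (intro sum.cong refl) simp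
qed

lemma bcirc_tminus_entry:
  assumes "\<And>k. k < p \<Longrightarrow> B k \<in> carrier_mat m m" "i < m * p" "j < m * p"
  shows "bcirc m m p (tminus A B) $$ (i, j) = bcirc m m p A $$ (i, j) - bcirc m m p B $$ (i, j)"
proof -
  note b = block_index_bounds[OF assms(2)] block_index_bounds[OF assms(3)]
  have "B ((i div m + p - j div m) mod p) \<in> carrier_mat m m" using assms(1) b by simp
  then show ?thesis unfolding bcirc_entry[OF assms(2,3)] tminus_def using b by simp
qed

lemma tsq_carrier: "tsq m p A k \<in> carrier_mat m m"
  by (simp add: tsq_def tprod_def)

lemma bcirc_tsum_entry:
  assumes "i < m * p" "j < m * p"
  shows "bcirc m m p (tsum m m A I) $$ (i, j) = (\<Sum>t\<in>I. bcirc m m p (A t) $$ (i, j))"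
  using block_index_bounds[OF assms(1)] block_index_bounds[OF assms(2)]
  unfolding bcirc_entry[OF assms] tsum_def by simp

lemma mapply_bcirc_tsq:
  assumes "i < m * p"
  shows "mapply (m * p) (entries (bcirc m m p (tsq m p A))) v i
    = mapply (m * p) (entries (bcirc m m p A)) (mapply (m * p) (entries (bcirc m m p A)) v) i"
proof -
  have "mapply (m * p) (entries (bcirc m m p (tsq m p A))) v i
      = (\<Sum>j<m * p. \<Sum>l<m * p. bcirc m m p A $$ (i, l) * bcirc m m p A $$ (l, j) * v j)"
    unfolding mapply_def using bcirc_tsq_entry[OF assms] by (simp add: sum_distrib_right)
  also have "\<dots> = (\<Sum>l<m * p. \<Sum>j<m * p. bcirc m m p A $$ (i, l) * bcirc m m p A $$ (l, j) * v j)"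
    by (rule sum.swap)
  finally show ?thesis by (simp add: mapply_def sum_distrib_left mult.assoc)
qed

text \<open>The square acts as two applications of a Hermitian matrix, one of which moves to the
  other side of the inner product.\<close>

lemma cinner_bcirc_tsq:
  assumes "hermitian_fun (m * p) (entries (bcirc m m p A))"
  shows "cinner (m * p) v (mapply (m * p) (entries (bcirc m m p (tsq m p A))) v)
    = of_real (sqnorm (m * p) (mapply (m * p) (entries (bcirc m m p A)) v))"
proof -
  have "cinner (m * p) v (mapply (m * p) (entries (bcirc m m p (tsq m p A))) v)
    = cinner (m * p) v (mapply (m * p) (entries (bcirc m m p A)) (mapply (m * p) (entries (bcirc m m p A)) v))"
    by (intro cinner_cong refl mapply_bcirc_tsq)
  then show ?thesis unfolding cinner_mapply_hermitian[OF assms] cinner_self .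
qed

section \<open>Quadratic forms and the semidefinite order\<close>

lemma mult_vec_eq_mapply:
  assumes "M \<in> carrier_mat d d" "i < d"
  shows "(M *\<^sub>v vec d v) $ i = mapply d (entries M) v i"
  using assms unfolding mapply_def by (auto simp: scalar_prod_def atLeast0LessThan intro!: sum.cong)

lemma mult_vec_of_fun:
  assumes "M \<in> carrier_mat d d"
  shows "M *\<^sub>v vec d v = vec d (mapply d (entries M) v)"
proof (rule eq_vecI)
  show "dim_vec (M *\<^sub>v vec d v) = dim_vec (vec d (mapply d (entries M) v))"
    using assms by simp
qed (simp add: mult_vec_eq_mapply[OF assms] del: index_mult_mat_vec)

lemma psd_mat_imp_cinner_nonneg:
  assumes "psd_mat d M"
  shows "0 \<le> Re (cinner d v (mapply d (entries M) v))"
proof -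
  have M: "M \<in> carrier_mat d d" using assms by (simp add: psd_mat_def)
  have "(M *\<^sub>v vec d v) \<bullet>c vec d v = (\<Sum>i<d. (M *\<^sub>v vec d v) $ i * cnj (v i))"
    unfolding scalar_prod_def by (simp add: atLeast0LessThan)
  also have "\<dots> = cinner d v (mapply d (entries M) v)"
    unfolding cinner_def using mult_vec_eq_mapply[OF M] by (intro sum.cong refl) (simp add: mult.commute)
  finally have "(M *\<^sub>v vec d v) \<bullet>c vec d v = \<dots>" .
  moreover have "0 \<le> Re ((M *\<^sub>v vec d v) \<bullet>c vec d v)"
    using assms unfolding psd_mat_def by simp
  ultimately show ?thesis by simp
qed

text \<open>The difference of the two tensors is Hermitian, so the form of its square is a squared
  length. This puts the tensor hypothesis into the shape of \<open>G_diff\<close>.\<close>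

lemma tle_imp_sqnorm_le:
  assumes B: "hermitian_tensor m p B" and C: "hermitian_tensor m p C"
    and le: "tle m p (tsq m p (tminus B C)) (tsq m p A)"
  shows "sqnorm (m * p) (mapply (m * p) (\<lambda>i j. bcirc m m p B $$ (i, j) - bcirc m m p C $$ (i, j)) v)
    \<le> Re (cinner (m * p) v (mapply (m * p) (entries (bcirc m m p (tsq m p A))) v))"
proof -
  let ?d = "m * p"
  let ?E = "entries (bcirc m m p (tminus B C))"
  let ?S = "entries (bcirc m m p (tsq m p A))" and ?T = "entries (bcirc m m p (tsq m p (tminus B C)))"
  have E: "?E i j = bcirc m m p B $$ (i, j) - bcirc m m p C $$ (i, j)" if "i < ?d" "j < ?d" for i j
    using C that unfolding hermitian_tensor_def is_tensor_def by (intro bcirc_tminus_entry) auto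
  have herm: "hermitian_fun ?d ?E"
    using hermitian_bcirc[OF B] hermitian_bcirc[OF C] E unfolding hermitian_fun_def
    by (metis complex_cnj_diff)
  have "0 \<le> Re (cinner ?d v (mapply ?d (entries (bcirc m m p (tminus (tsq m p A) (tsq m p (tminus B C))))) v))"
    using le unfolding tle_def by (rule psd_mat_imp_cinner_nonneg)
  also have "cinner ?d v (mapply ?d (entries (bcirc m m p (tminus (tsq m p A) (tsq m p (tminus B C))))) v)
      = cinner ?d v (\<lambda>i. mapply ?d ?S v i - mapply ?d ?T v i)"
    unfolding mapply_def
    by (intro cinner_cong refl) (simp add: bcirc_tminus_entry tsq_carrier sum_subtractf[symmetric] algebra_simps)
  also have "\<dots> = cinner ?d v (mapply ?d ?S v) - cinner ?d v (mapply ?d ?T v)"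
    unfolding cinner_def by (simp add: sum_subtractf algebra_simps)
  also have "cinner ?d v (mapply ?d ?T v) = of_real (sqnorm ?d (mapply ?d ?E v))"
    by (rule cinner_bcirc_tsq[OF herm])
  also have "sqnorm ?d (mapply ?d ?E v)
      = sqnorm ?d (mapply ?d (\<lambda>i j. bcirc m m p B $$ (i, j) - bcirc m m p C $$ (i, j)) v)"
    unfolding sqnorm_def by (intro sum.cong refl) (simp add: E cong: mapply_cong)
  finally show ?thesis by simp
qed

section \<open>Norm and largest eigenvalue of a tensor\<close>

lemma eigenvalue_set_finite:
  assumes "M \<in> carrier_mat d d"
  shows "finite {Re c | c. eigenvalue M c}"
proof -
  have "{Re c | c. eigenvalue M c} = Re ` spectrum M" unfolding spectrum_def by auto
  then show ?thesis using card_finite_spectrum(1)[OF assms] by simp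
qed

lemma mapply_twice_eigenbasis:
  assumes "eigenbasis d H lam u" "k < d" "i < d"
  shows "mapply d H (mapply d H (u k)) i = of_real ((lam k)\<^sup>2) * u k i"
proof -
  have "mapply d H (mapply d H (u k)) i = (\<Sum>j<d. H i j * (of_real (lam k) * u k j))"
    unfolding mapply_def[of d H "mapply d H (u k)"]
    using eigenbasis_apply[OF assms(1,2)] by (intro sum.cong refl) simp
  also have "\<dots> = of_real (lam k) * mapply d H (u k) i"
    unfolding mapply_def sum_distrib_left by (intro sum.cong refl) simp
  finally show ?thesis
    using eigenbasis_apply[OF assms] by (simp add: power2_eq_square)
qed

text \<open>The adjoint of the Hermitian block circulant is the matrix itself, so
  \<open>tnorm\<close> is the root of the largest eigenvalue of its square, and
  \<open>(lam k)^2\<close> is one of these eigenvalues.\<close>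

lemma eigenbasis_le_tnorm:
  assumes herm: "hermitian_fun (m * p) (entries (bcirc m m p T))"
    and eb: "eigenbasis (m * p) (entries (bcirc m m p T)) lam u" and k: "k < m * p"
  shows "\<bar>lam k\<bar> \<le> tnorm m m p T"
proof -
  let ?d = "m * p" and ?B = "bcirc m m p T"
  have adj: "mat_adjoint ?B = ?B"
  proof (rule eq_matI)
    show "dim_row (mat_adjoint ?B) = dim_row ?B" "dim_col (mat_adjoint ?B) = dim_col ?B"
      by (simp_all add: mat_adjoint_def bcirc_def)
    fix i j assume "i < dim_row ?B" "j < dim_col ?B"
    then have ij: "i < ?d" "j < ?d"
      using carrier_matD[OF bcirc_carrier, of m m p T] by auto
    show "mat_adjoint ?B $$ (i, j) = ?B $$ (i, j)"
      unfolding mat_adjoint_entry[OF bcirc_carrier ij]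
      using herm ij unfolding hermitian_fun_def by metis
  qed
  have BB: "?B * ?B \<in> carrier_mat ?d ?d" by (meson bcirc_carrier mult_carrier_mat)
  have eq: "(?B * ?B) *\<^sub>v vec ?d (u k) = of_real ((lam k)\<^sup>2) \<cdot>\<^sub>v vec ?d (u k)"
  proof -
    have "(?B * ?B) *\<^sub>v vec ?d (u k) = ?B *\<^sub>v (?B *\<^sub>v vec ?d (u k))"
      by (intro assoc_mult_mat_vec) (rule bcirc_carrier vec_carrier)+
    also have "\<dots> = vec ?d (mapply ?d (entries ?B) (mapply ?d (entries ?B) (u k)))"
      by (simp only: mult_vec_of_fun[OF bcirc_carrier])
    also have "\<dots> = of_real ((lam k)\<^sup>2) \<cdot>\<^sub>v vec ?d (u k)"
      by (intro eq_vecI) (simp_all add: mapply_twice_eigenbasis[OF eb k])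
    finally show ?thesis .
  qed
  have "vec ?d (u k) \<noteq> 0\<^sub>v ?d"
  proof
    assume "vec ?d (u k) = 0\<^sub>v ?d"
    then have "\<forall>i<?d. u k i = 0" by (metis index_vec index_zero_vec(1))
    then show False using sqnorm_eigenbasis[OF eb k] sqnorm_eq_0_iff[of ?d "u k"] by simp
  qed
  then have "eigenvector (?B * ?B) (vec ?d (u k)) (of_real ((lam k)\<^sup>2))"
    unfolding eigenvector_def using eq BB by (simp add: bcirc_def)
  then have "(lam k)\<^sup>2 \<in> {Re c | c. eigenvalue (?B * ?B) c}"
    unfolding eigenvalue_def by (metis (mono_tags, lifting) Re_complex_of_real mem_Collect_eq)
  then have "(lam k)\<^sup>2 \<le> Max {Re c | c. eigenvalue (?B * ?B) c}"
    by (intro Max_ge eigenvalue_set_finite[OF BB])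
  then show ?thesis
    unfolding tnorm_def adj by (metis real_sqrt_abs real_sqrt_le_mono)
qed

text \<open>The Rayleigh bound: the form is a combination of the eigenvalues with weights that sum
  to \<open>sqnorm\<close> by Parseval.\<close>

lemma cinner_le_tnorm:
  assumes herm: "hermitian_fun (m * p) (entries (bcirc m m p T))"
  shows "Re (cinner (m * p) v (mapply (m * p) (entries (bcirc m m p T)) v)) \<le> tnorm m m p T * sqnorm (m * p) v"
proof -
  let ?d = "m * p" and ?H = "entries (bcirc m m p T)"
  obtain lam u where eb: "eigenbasis ?d ?H lam u" using hermitian_eigenbasis_exists[OF herm] by blast
  have "cinner ?d v (mapply ?d ?H v) = (\<Sum>k<?d. of_real (lam k * (cmod (cinner ?d (u k) v))\<^sup>2))"
    unfolding cinner_expand[OF eb, of v "mapply ?d ?H v"]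
  proof (intro sum.cong refl)
    fix k assume "k \<in> {..<?d}"
    then have "cinner ?d (u k) (mapply ?d ?H v) = cinner ?d (\<lambda>i. of_real (lam k) * u k i) v"
      unfolding cinner_mapply_hermitian[OF herm]
      using eigenbasis_apply[OF eb] by (intro cinner_cong) auto
    moreover have "cinner ?d v (u k) * cinner ?d (u k) v = of_real ((cmod (cinner ?d (u k) v))\<^sup>2)"
      by (subst cinner_commute) (metis complex_norm_square mult.commute of_real_power)
    ultimately show "cinner ?d v (u k) * cinner ?d (u k) (mapply ?d ?H v)
        = of_real (lam k * (cmod (cinner ?d (u k) v))\<^sup>2)"
      by (simp add: cinner_smult_left mult.left_commute)
  qed
  then have "Re (cinner ?d v (mapply ?d ?H v)) = (\<Sum>k<?d. lam k * (cmod (cinner ?d (u k) v))\<^sup>2)"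
    by (simp flip: of_real_sum)
  also have "\<dots> \<le> (\<Sum>k<?d. tnorm m m p T * (cmod (cinner ?d (u k) v))\<^sup>2)"
    using eigenbasis_le_tnorm[OF herm eb] by (intro sum_mono mult_right_mono) (auto simp: abs_le_iff)
  finally show ?thesis unfolding sum_distrib_left[symmetric] parseval[OF eb] .
qed

lemma tnorm_nonneg:
  assumes herm: "hermitian_fun (m * p) (entries (bcirc m m p T))" and "0 < m * p"
  shows "0 \<le> tnorm m m p T"
  using hermitian_eigenbasis_exists[OF herm] eigenbasis_le_tnorm[OF herm _ assms(2)]
  by (meson abs_ge_zero order_trans)

text \<open>In positive dimension the spectrum is finite and nonempty, so the maximum is
  attained.\<close>

lemma lambda_max_eigenvector:
  assumes "0 < m * p"
  shows "\<exists>c v. lambda_max m p T = Re c \<and> (\<exists>i<m * p. v i \<noteq> 0) \<and>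
    (\<forall>i<m * p. mapply (m * p) (entries (bcirc m m p T)) v i = c * v i)"
proof -
  let ?d = "m * p" and ?B = "bcirc m m p T"
  have "{Re c | c. eigenvalue ?B c} \<noteq> {}"
    using spectrum_non_empty[OF bcirc_carrier assms, of T] unfolding spectrum_def by auto
  then have "lambda_max m p T \<in> {Re c | c. eigenvalue ?B c}"
    unfolding lambda_max_def by (intro Max_in eigenvalue_set_finite[OF bcirc_carrier])
  then obtain c w where c: "lambda_max m p T = Re c" and w: "w \<in> carrier_vec ?d" "w \<noteq> 0\<^sub>v ?d" "?B *\<^sub>v w = c \<cdot>\<^sub>v w"
    unfolding eigenvalue_def eigenvector_def using carrier_matD(1)[OF bcirc_carrier, of m m p T] by auto
  define v where "v = (\<lambda>i. w $ i)"
  have wv: "w = vec ?d v" using w(1) by (auto simp: v_def)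
  have "\<exists>i<?d. v i \<noteq> 0"
    using w(1,2) unfolding v_def by (metis carrier_vecD eq_vecI index_zero_vec)
  moreover have "mapply ?d (entries ?B) v i = c * v i" if "i < ?d" for i
    using mult_vec_eq_mapply[OF bcirc_carrier that, of T v] w that unfolding wv[symmetric]
    by (simp add: v_def del: index_mult_mat_vec)
  ultimately show ?thesis using c by blast
qed

section \<open>Transfer from random tensors to the product space\<close>

theorem theorem12:
  fixes M :: "'s measure" and N :: "nat \<Rightarrow> 'b measure"
    and X :: "nat \<Rightarrow> 's \<Rightarrow> 'b"
    and F :: "(nat \<Rightarrow> 'b) \<Rightarrow> tensor"
    and A :: "nat \<Rightarrow> tensor"
    and m p n :: nat and \<theta> :: real
  assumes "m \<ge> 1" "p \<ge> 1" "n \<ge> 1"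
    and "prob_space M"
    and X_meas: "\<And>i. i < n \<Longrightarrow> X i \<in> measurable M (N i)"
    and indep: "prob_space.indep_vars M N X {..<n}"
    and F_herm: "\<And>x. x \<in> (\<Pi>\<^sub>E i\<in>{..<n}. space (N i)) \<Longrightarrow> hermitian_tensor m p (F x)"
    and F_meas: "\<And>k i j. k < p \<Longrightarrow> i < m \<Longrightarrow> j < m \<Longrightarrow>
        (\<lambda>x. F x k $$ (i, j)) \<in> borel_measurable (\<Pi>\<^sub>M i\<in>{..<n}. N i)"
    and A_herm: "\<And>i. i < n \<Longrightarrow> hermitian_tensor m p (A i)"
    and bdd: "\<And>i x x'. i < n \<Longrightarrow> x \<in> (\<Pi>\<^sub>E i\<in>{..<n}. space (N i)) \<Longrightarrow> x' \<in> space (N i) \<Longrightarrow>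
        tle m p (tsq m p (tminus (F x) (F (x(i := x'))))) (tsq m p (A i))"
    and "\<theta> \<ge> 0"
  shows "let \<sigma>2 = tnorm m m p (tsum m m (\<lambda>i. tsq m p (A i)) {..<n});
             FX = (\<lambda>\<omega>. F (\<lambda>i\<in>{..<n}. X i \<omega>));
             EF = (\<lambda>k. mat m m (\<lambda>(i, j). prob_space.expectation M (\<lambda>\<omega>. FX \<omega> k $$ (i, j))))
         in measure M {\<omega> \<in> space M. lambda_max m p (tminus (FX \<omega>) EF) \<ge> \<theta>}
            \<le> real (m * p) * exp (- \<theta>\<^sup>2 / (8 * \<sigma>2))"
proof -
  interpret M: prob_space M by fact
  define d where "d = m * p"
  have d: "0 < d" using assms(1,2) by (simp add: d_def)
  \<comment> \<open>\<open>Q i\<close> is the law of \<open>X i\<close>; from \<open>n\<close> on, a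
    point mass on an arbitrary space keeps every factor a probability space.\<close>
  define Q where "Q i = (if i < n then distr M (N i) (X i) else return (count_space UNIV) undefined)" for i
  have Q: "prob_space (Q i)" for i
    unfolding Q_def using X_meas by (auto intro!: M.prob_space_distr prob_space_return)
  have sets_Q: "sets (Q i) = sets (N i)" "space (Q i) = space (N i)" if "i < n" for i
    using that by (auto simp: Q_def)
  define J where "J \<omega> = (\<lambda>i\<in>{..<n}. X i \<omega>)" for \<omega>
  interpret product_of_prob n Q by (rule product_of_prob.intro) (rule Q)
  have sets_P: "sets P = sets (PiM {..<n} N)"
    by (rule sets_PiM_cong) (auto simp: sets_Q)
  have space_P: "space P = (\<Pi>\<^sub>E i\<in>{..<n}. space (N i))"
    unfolding space_PiM by (rule PiE_cong) (simp add: sets_Q)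
  \<comment> \<open>Independence says that the joint law is the product of the marginals; the
    criterion used here asks for a nonempty index set.\<close>
  have "distr M (PiM {..<n} N) J = PiM {..<n} (\<lambda>i. distr M (N i) (X i))"
    using M.indep_vars_iff_distr_eq_PiM'[where I = "{..<n}" and M' = N and X = X] X_meas indep \<open>n \<ge> 1\<close>
    unfolding J_def by (auto simp: lessThan_empty_iff)
  also have "\<dots> = P" by (rule PiM_cong) (auto simp: Q_def)
  finally have law: "distr M P J = P"
    using sets_P by (metis distr_cong)
  have J_meas: "J \<in> measurable M P"
    unfolding J_def measurable_cong_sets[OF refl sets_P] using X_meas by (intro measurable_restrict) auto
  define G where "G x = entries (bcirc m m p (F x))" for x
  define S where "S k = entries (bcirc m m p (tsq m p (A k)))" for k
  define T where "T = tsum m m (\<lambda>i. tsq m p (A i)) {..<n}"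
  define s where "s = tnorm m m p T"
  have S_herm: "hermitian_fun d (S k)" if "k < n" for k
    unfolding S_def d_def by (intro hermitian_bcirc_tsq hermitian_bcirc A_herm that)
  have T_entry: "bcirc m m p T $$ (i, j) = (\<Sum>k<n. S k i j)" if "i < d" "j < d" for i j
    using that unfolding T_def S_def d_def by (rule bcirc_tsum_entry)
  have T_herm: "hermitian_fun d (entries (bcirc m m p T))"
    unfolding hermitian_fun_def
  proof (intro allI impI)
    fix i j assume ij: "i < d" "j < d"
    have "S k i j = cnj (S k j i)" if "k < n" for k
      using S_herm[OF that] ij unfolding hermitian_fun_def by blast
    then show "bcirc m m p T $$ (i, j) = cnj (bcirc m m p T $$ (j, i))"
      unfolding T_entry[OF ij] T_entry[OF ij(2,1)] cnj_sum by (intro sum.cong refl) simp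
  qed
  have s_nonneg: "0 \<le> s"
    unfolding s_def using T_herm d unfolding d_def by (rule tnorm_nonneg)
  interpret matrix_bounded_differences n Q d G S s
  proof
    fix i j assume ij: "i < d" "j < d"
    then have "(i div m + p - j div m) mod p < p" "i mod m < m" "j mod m < m"
      using assms(1,2) by simp_all
    then show "(\<lambda>x. G x i j) \<in> borel_measurable P"
      using F_meas ij unfolding G_def measurable_cong_sets[OF sets_P refl] d_def
      by (simp add: bcirc_entry)
  next
    fix x assume "x \<in> space P"
    then show "hermitian_fun d (G x)"
      unfolding G_def d_def space_P by (intro hermitian_bcirc F_herm)
  next
    fix k x y v assume k: "k < n" and x: "x \<in> space P" and y: "y \<in> space (Q k)"
    then have x': "x \<in> (\<Pi>\<^sub>E i\<in>{..<n}. space (N i))" and y': "y \<in> space (N k)"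
      by (simp_all add: space_P sets_Q)
    have "x(k := y) \<in> (\<Pi>\<^sub>E i\<in>{..<n}. space (N i))"
      using x' y' k by (auto simp: PiE_iff extensional_def)
    then show "sqnorm d (mapply d (\<lambda>i j. G x i j - G (x(k := y)) i j) v) \<le> Re (cinner d v (mapply d (S k) v))"
      unfolding G_def S_def d_def by (intro tle_imp_sqnorm_le F_herm bdd x' y' k)
  next
    fix v
    have "cinner d v (mapply d (entries (bcirc m m p T)) v) = cinner d v (\<lambda>i. \<Sum>k<n. mapply d (S k) v i)"
      unfolding mapply_sum_matrix[symmetric] by (intro cinner_cong refl mapply_cong T_entry)
    also have "\<dots> = (\<Sum>k<n. cinner d v (mapply d (S k) v))" by (rule cinner_sum_right)
    finally show "(\<Sum>k<n. Re (cinner d v (mapply d (S k) v))) \<le> s * sqnorm d v"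
      using cinner_le_tnorm[OF T_herm[unfolded d_def], of v] by (simp add: s_def d_def)
  qed (rule s_nonneg)
  define EF where "EF = (\<lambda>k. mat m m (\<lambda>(i, j). M.expectation (\<lambda>\<omega>. F (J \<omega>) k $$ (i, j))))"
  define E where "E = {\<omega> \<in> space M. lambda_max m p (tminus (F (J \<omega>)) EF) \<ge> \<theta>}"
  \<comment> \<open>The expectation on the original space is an integral against the joint law, so
    centring the tensor agrees with centring \<open>G\<close> on the product space.\<close>
  have Y_entry: "bcirc m m p (tminus (F (J \<omega>)) EF) $$ (i, j) = Y (J \<omega>) i j" if "i < d" "j < d" for i j \<omega>
  proof -
    have "EG i j = M.expectation (\<lambda>\<omega>. G (J \<omega>) i j)"
      unfolding EG_def by (subst law[symmetric], rule integral_distr[OF J_meas G_measurable[OF that]])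
    also have "\<dots> = bcirc m m p EF $$ (i, j)"
      using that assms(1,2) unfolding d_def EF_def G_def by (simp add: bcirc_entry)
    finally show ?thesis
      using that bcirc_tminus_entry[of p EF m i j "F (J \<omega>)"] unfolding d_def Y_def G_def
      by (simp add: EF_def)
  qed
  have "measure M E \<le> real d * exp (- \<theta>\<^sup>2 / (8 * s))"
  proof (cases "s = 0")
    \<comment> \<open>Division by zero gives 0, so the exponential is 1 and the bound is
      \<open>real d\<close>, at least 1.\<close>
    case True
    then show ?thesis using order_trans[OF M.prob_le_1[of E], of "real d"] d by simp
  next
    case False
    then have s: "s > 0" using s_nonneg by simp
    define t where "t = \<theta> / (4 * s)"
    have t: "t \<ge> 0" using s \<open>\<theta> \<ge> 0\<close> by (simp add: t_def)
    \<comment> \<open>The event for \<open>lambda_max\<close> is enclosed in the preimage of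
      \<open>B\<close>, whose measurability follows from that of \<open>trexp\<close>; monotonicity
      of the measure needs it for the larger set.\<close>
    define B where "B = {x \<in> space P. exp (t * \<theta>) \<le> trexp t x}"
    have B: "B \<in> sets P" unfolding B_def using trexp_measurable[of t] by measurable
    have "E \<subseteq> J -` B \<inter> space M"
    proof
      fix \<omega> assume "\<omega> \<in> E"
      then have \<omega>: "\<omega> \<in> space M" and le: "\<theta> \<le> lambda_max m p (tminus (F (J \<omega>)) EF)"
        by (simp_all add: E_def)
      have J: "J \<omega> \<in> space P" using measurable_space[OF J_meas \<omega>] .
      obtain c v where c: "\<theta> \<le> Re c" and v: "\<exists>i<d. v i \<noteq> 0"
        and ev: "\<forall>i<d. mapply d (entries (bcirc m m p (tminus (F (J \<omega>)) EF))) v i = c * v i"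
        using lambda_max_eigenvector[of m p "tminus (F (J \<omega>)) EF"] le d unfolding d_def by metis
      have "mapply d (Y (J \<omega>)) v i = c * v i" if i: "i < d" for i
      proof -
        have "mapply d (entries (bcirc m m p (tminus (F (J \<omega>)) EF))) v i = mapply d (Y (J \<omega>)) v i"
          by (intro mapply_cong Y_entry i)
        then show ?thesis using ev i by simp
      qed
      then have "exp (t * \<theta>) \<le> trexp t (J \<omega>)"
        by (intro trexp_ge_eigenvalue[OF J _ v c t])
      then show "\<omega> \<in> J -` B \<inter> space M" using J \<omega> by (simp add: B_def)
    qed
    then have "measure M E \<le> measure M (J -` B \<inter> space M)"
      by (intro M.finite_measure_mono measurable_sets[OF J_meas B])
    also have "\<dots> = measure P B"
      using measure_distr[OF J_meas B] unfolding law by simp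
    also have "\<dots> \<le> real d * exp (- \<theta>\<^sup>2 / (8 * s))"
      unfolding B_def t_def by (rule trexp_tail[OF s \<open>\<theta> \<ge> 0\<close>])
    finally show ?thesis .
  qed
  then show ?thesis
    unfolding Let_def E_def EF_def J_def s_def T_def d_def .
qed

end
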